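(* Let $S$ be the Sierpinski gasket in $\mathbb{R}^2$ with boundary vertices $\Gamma$, let $(V^n,\sim)$ and $S^n$ be its $n$-th prefractal graph and network, $h_n=2^{-n}$, let $f:S\to\mathbb{R}$ be continuous with $\inf_S f>0$ and modulus of continuity $\omega_f$, and let $g:\Gamma\to\mathbb{R}$ satisfy, for every $n\in\mathbb{N}$, $$g(x)\le \inf\Big\{\sum_{k=0}^{N-1}h_nf(x_k)+g(y)\Big\}\qquad\text{for all }x,y\in\Gamma,$$ where the infimum is over all finite paths $\{x_0=x,x_1,\dots,x_N=y\}\subset V^n$ with $x_i\sim x_{i+1}$. For each $n$ let $u_{h_n}:V^n\to\mathbb{R}$ be the solution of $$\max_{y\sim x}\Big\{-\frac1{h_n}\big(u(y)-u(x)\big)\Big\}=f(x)\quad\text{for } x\in V^n\setminus\Gamma,\qquad u=g\ \text{ on }\Gamma,$$ and let $u_n:S^n\to\mathbb{R}$ be the (network) viscosity solution of $|Du|=f$ in $S^n\setminus\Gamma$ with $u_n=g$ on $\Gamma$. Then there is a constant $C$, independent of $n$, such that $$|u_n(x)-u_{h_n}(x)|\le C\,\omega_f(h_n^{1/2})\qquad\forall x\in V^n .$$ Hence the sequences $u_{h_n}$ and $u_n$ converge to the same limit on $S$: there is a continuous $\bar u:S\to\mathbb{R}$ with $\sup_{S^n}|u_n-\bar u|\to0$ and $\sup_{V^n}|u_{h_n}-\bar u|\to0$ as $n\to\infty$.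
   Context: **Gasket and prefractals.** $a_1,a_2,a_3$ are the vertices of an equilateral triangle of side $1$ in $\mathbb{R}^2$, $\Gamma=\{a_1,a_2,a_3\}$, $\psi_i(x)=a_i+\frac12(x-a_i)$. $V^n$ is the union of the images of $\Gamma$ under all $n$-fold compositions $\psi_{i_1}\circ\dots\circ\psi_{i_n}$; $S$ is the closure of $\bigcup_nV^n$. $E^n$ is the set of closed segments (edges, each of length $h_n=2^{-n}$) that are images of a side of the initial triangle under some $\psi_{i_1}\circ\dots\circ\psi_{i_n}$; $x\sim y$ for $x,y\in V^n$ iff they are the endpoints of an edge in $E^n$; $S^n\subset S$ is the union of the edges; $V^n_0=V^n\setminus\Gamma$. A single vertex ($N=0$) is an admissible path, with empty sum equal to $0$. **Modulus of continuity.** $\omega_f(r)=\sup\{|f(x)-f(y)|: x,y\in S,\ d(x,y)\le r\}$, where $d$ is the geodesic distance on $S$ (infimum of lengths of paths in $S$ joining $x$ and $y$). **Network viscosity solutions on $S^n$.** Label the edges of $E^n$ as $e_j$ and let $\pi_j:[0,h_n]\to e_j$ be an arc-length parametrization. For $x_i\in V^n$ let $Inc_i=\{j: x_i\in e_j\}$, and $a_{ij}=1$ if $\pi_j(0)=x_i$, $a_{ij}=-1$ if $\pi_j(h_n)=x_i$. For $\phi:S^n\to\mathbb{R}$ put $\phi_j=\phi\circ\pi_j$ and $D_j\phi(x)=\phi_j'(\pi_j^{-1}(x))$ (one-sided at endpoints). For $x$ in the relative interior of $e_j$, a test function at $x$ is a $\phi\in C(S^n)$ with $\phi_j$ differentiable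 at $\pi_j^{-1}(x)$. For $x=x_i\in V_0^n$ and $j\ne k$ in $Inc_i$, a $(j,k)$-test function at $x$ is a $\phi\in C(S^n)$ with $\phi_j,\phi_k$ differentiable at $\pi_j^{-1}(x)$, $\pi_k^{-1}(x)$ and $a_{ij}D_j\phi(x)+a_{ik}D_k\phi(x)=0$. An upper semicontinuous $u$ on $S^n$ is a subsolution of $|Du|=f$ if (a) at each $x$ interior to an edge $e_j$, $|D_j\phi(x)|\le f(x)$ for every test function $\phi$ at $x$ such that $u-\phi$ has a local maximum at $x$; (b) at each $x=x_i\in V^n_0$, for all $j\ne k$ in $Inc_i$ and all $(j,k)$-test functions $\phi$ such that $u-\phi$ has a local maximum at $x$ relative to $e_j\cup e_k$, $|D_j\phi(x)|\le f(x)$. A lower semicontinuous $v$ on $S^n$ is a supersolution if (a) at each $x$ interior to an edge $e_j$, $|D_j\phi(x)|\ge f(x)$ for every test function $\phi$ at $x$ such that $v-\phi$ has a local minimum at $x$; (b) at each $x=x_i\in V^n_0$, for every $j\in Inc_i$ there is $k\in Inc_i\setminus\{j\}$ such that for all $(j,k)$-test functions $\phi$ for which $v-\phi$ has a local minimum at $x$ relative to $e_j\cup e_k$, $|D_j\phi(x)|\ge f(x)$. A solution is both. Known fact: if $g(x)\le\int_0^Tf(\xi(t))dt+g(y)$ for all $x,y\in\Gamma$ and all piecewise differentiable paths $\xi:[0,T]\to S^n$ with speed at most $1$ from $x$ to $y$ (which follows from the assumption on $g$ in the claim), the unique solution with $u_n=g$ on $\Gamma$ is $u_n(x)=\inf\{\int_0^T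 f(\xi(t))dt+g(y)\}$, the infimum over $y\in\Gamma$ and such paths $\xi$ with $\xi(0)=x$, $\xi(T)=y$. *)

theory Defs
  imports "HOL-Analysis.Analysis"
begin

section \<open>The Sierpinski gasket and its prefractals\<close>

text \<open>The three vertices of the initial triangle are given by a function \<open>a\<close> on the
  three-element type \<open>3\<close>.\<close>

definition contraction :: "(3 \<Rightarrow> real^2) \<Rightarrow> 3 \<Rightarrow> real^2 \<Rightarrow> real^2" where
  "contraction a i x = a i + (1/2) *\<^sub>R (x - a i)"

text \<open>\<open>word_map a [i\<^sub>1, \<dots>, i\<^sub>n]\<close> is the composition of the contractions with indices
  \<open>i\<^sub>1, \<dots>, i\<^sub>n\<close>, the one with index \<open>i\<^sub>n\<close> being applied first.\<close>

definition word_map :: "(3 \<Rightarrow> real^2) \<Rightarrow> 3 list \<Rightarrow> real^2 \<Rightarrow> real^2" where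
  "word_map a w = foldr (contraction a) w"

definition vertices :: "(3 \<Rightarrow> real^2) \<Rightarrow> nat \<Rightarrow> (real^2) set" where
  "vertices a n = (\<Union>w\<in>{w. length w = n}. word_map a w ` range a)"

definition inner_vertices :: "(3 \<Rightarrow> real^2) \<Rightarrow> nat \<Rightarrow> (real^2) set" where
  "inner_vertices a n = vertices a n - range a"

definition gasket :: "(3 \<Rightarrow> real^2) \<Rightarrow> (real^2) set" where
  "gasket a = closure (\<Union>n. vertices a n)"

definition edges :: "(3 \<Rightarrow> real^2) \<Rightarrow> nat \<Rightarrow> (real^2) set set" where
  "edges a n = {word_map a w ` closed_segment (a i) (a j) | w i j. length w = n \<and> i \<noteq> j}"

definition network :: "(3 \<Rightarrow> real^2) \<Rightarrow> nat \<Rightarrow> (real^2) set" where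
  "network a n = \<Union>(edges a n)"

definition mesh :: "nat \<Rightarrow> real" where
  "mesh n = (1/2) ^ n"

definition adj :: "(3 \<Rightarrow> real^2) \<Rightarrow> nat \<Rightarrow> real^2 \<Rightarrow> real^2 \<Rightarrow> bool" where
  "adj a n x y \<longleftrightarrow> x \<in> vertices a n \<and> y \<in> vertices a n \<and> closed_segment x y \<in> edges a n"

definition graph_path :: "(3 \<Rightarrow> real^2) \<Rightarrow> nat \<Rightarrow> real^2 \<Rightarrow> real^2 \<Rightarrow> (real^2) list \<Rightarrow> bool" where
  "graph_path a n x y xs \<longleftrightarrow>
     xs \<noteq> [] \<and> hd xs = x \<and> last xs = y \<and> set xs \<subseteq> vertices a n \<and> successively (adj a n) xs"


section \<open>Geodesic distance and modulus of continuity\<close>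

text \<open>Supremum of the lengths of inscribed polygons; it is infinite exactly for
  non-rectifiable curves.\<close>

definition curve_length :: "(real \<Rightarrow> 'a::metric_space) \<Rightarrow> ennreal" where
  "curve_length \<gamma> = (SUP ts\<in>{ts. sorted ts \<and> set ts \<subseteq> {0..1}}.
     ennreal (\<Sum>i<length ts - 1. dist (\<gamma> (ts ! i)) (\<gamma> (ts ! Suc i))))"

definition geodesic_dist :: "'a::metric_space set \<Rightarrow> 'a \<Rightarrow> 'a \<Rightarrow> ennreal" where
  "geodesic_dist X x y =
     (INF \<gamma>\<in>{\<gamma>. path \<gamma> \<and> path_image \<gamma> \<subseteq> X \<and> pathstart \<gamma> = x \<and> pathfinish \<gamma> = y}. curve_length \<gamma>)"

definition modulus_of_continuity :: "'a::metric_space set \<Rightarrow> ('a \<Rightarrow> real) \<Rightarrow> real \<Rightarrow> real" where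
  "modulus_of_continuity X f r =
     Sup {\<bar>f x - f y\<bar> | x y. x \<in> X \<and> y \<in> X \<and> geodesic_dist X x y \<le> ennreal r}"


section \<open>The discrete problem\<close>

definition discrete_solution ::
  "(3 \<Rightarrow> real^2) \<Rightarrow> nat \<Rightarrow> (real^2 \<Rightarrow> real) \<Rightarrow> (real^2 \<Rightarrow> real) \<Rightarrow> (real^2 \<Rightarrow> real) \<Rightarrow> bool" where
  "discrete_solution a n f g u \<longleftrightarrow>
     (\<forall>x\<in>inner_vertices a n. Max ((\<lambda>y. - (1 / mesh n) * (u y - u x)) ` {y. adj a n y x}) = f x) \<and>
     (\<forall>x\<in>range a. u x = g x)"


section \<open>Viscosity solutions on the network\<close>

definition usc_on :: "'a::topological_space set \<Rightarrow> ('a \<Rightarrow> real) \<Rightarrow> bool" where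
  "usc_on X u \<longleftrightarrow> (\<forall>x\<in>X. \<forall>c>u x. eventually (\<lambda>y. u y < c) (at x within X))"

definition lsc_on :: "'a::topological_space set \<Rightarrow> ('a \<Rightarrow> real) \<Rightarrow> bool" where
  "lsc_on X u \<longleftrightarrow> (\<forall>x\<in>X. \<forall>c<u x. eventually (\<lambda>y. c < u y) (at x within X))"

definition local_max_on :: "'a::topological_space set \<Rightarrow> ('a \<Rightarrow> real) \<Rightarrow> 'a \<Rightarrow> bool" where
  "local_max_on X F x \<longleftrightarrow> eventually (\<lambda>y. F y \<le> F x) (at x within X)"

definition local_min_on :: "'a::topological_space set \<Rightarrow> ('a \<Rightarrow> real) \<Rightarrow> 'a \<Rightarrow> bool" where
  "local_min_on X F x \<longleftrightarrow> eventually (\<lambda>y. F x \<le> F y) (at x within X)"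

text \<open>An edge is its own label, so a family \<open>p\<close> of parametrizations maps an edge \<open>e\<close> to
  \<open>p e\<close>. As edges are segments, arc-length parametrizations are the isometries of
  \<open>{0..mesh n}\<close> onto \<open>e\<close>; both orientations are allowed.\<close>

type_synonym param = "(real^2) set \<Rightarrow> real \<Rightarrow> real^2"

definition arc_length_params :: "(3 \<Rightarrow> real^2) \<Rightarrow> nat \<Rightarrow> param \<Rightarrow> bool" where
  "arc_length_params a n p \<longleftrightarrow> (\<forall>e\<in>edges a n. p e ` {0..mesh n} = e \<and>
     (\<forall>s\<in>{0..mesh n}. \<forall>t\<in>{0..mesh n}. dist (p e s) (p e t) = \<bar>s - t\<bar>))"

definition Inc :: "(3 \<Rightarrow> real^2) \<Rightarrow> nat \<Rightarrow> real^2 \<Rightarrow> (real^2) set set" where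
  "Inc a n x = {e\<in>edges a n. x \<in> e}"

definition edge_sign :: "nat \<Rightarrow> param \<Rightarrow> real^2 \<Rightarrow> (real^2) set \<Rightarrow> real" where
  "edge_sign n p x e = (if p e 0 = x then 1 else if p e (mesh n) = x then -1 else 0)"

definition param_inv :: "nat \<Rightarrow> param \<Rightarrow> (real^2) set \<Rightarrow> real^2 \<Rightarrow> real" where
  "param_inv n p e x = the_inv_into {0..mesh n} (p e) x"

text \<open>Taking derivatives within \<open>{0..mesh n}\<close> makes them one-sided at the endpoints.\<close>

definition edge_differentiable ::
  "nat \<Rightarrow> param \<Rightarrow> (real^2) set \<Rightarrow> (real^2 \<Rightarrow> real) \<Rightarrow> real^2 \<Rightarrow> bool" where
  "edge_differentiable n p e \<phi> x \<longleftrightarrow>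
     (\<phi> \<circ> p e) differentiable (at (param_inv n p e x) within {0..mesh n})"

definition edge_deriv ::
  "nat \<Rightarrow> param \<Rightarrow> (real^2) set \<Rightarrow> (real^2 \<Rightarrow> real) \<Rightarrow> real^2 \<Rightarrow> real" where
  "edge_deriv n p e \<phi> x =
     vector_derivative (\<phi> \<circ> p e) (at (param_inv n p e x) within {0..mesh n})"

definition test_fun ::
  "(3 \<Rightarrow> real^2) \<Rightarrow> nat \<Rightarrow> param \<Rightarrow> (real^2) set \<Rightarrow> real^2 \<Rightarrow> (real^2 \<Rightarrow> real) \<Rightarrow> bool" where
  "test_fun a n p e x \<phi> \<longleftrightarrow> continuous_on (network a n) \<phi> \<and> edge_differentiable n p e \<phi> x"

definition vertex_test_fun ::
  "(3 \<Rightarrow> real^2) \<Rightarrow> nat \<Rightarrow> param \<Rightarrow> (real^2) set \<Rightarrow> (real^2) set \<Rightarrow> real^2 \<Rightarrow> (real^2 \<Rightarrow> real) \<Rightarrow> bool" where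
  "vertex_test_fun a n p e e' x \<phi> \<longleftrightarrow>
     continuous_on (network a n) \<phi> \<and>
     edge_differentiable n p e \<phi> x \<and> edge_differentiable n p e' \<phi> x \<and>
     edge_sign n p x e * edge_deriv n p e \<phi> x + edge_sign n p x e' * edge_deriv n p e' \<phi> x = 0"

definition subsolution ::
  "(3 \<Rightarrow> real^2) \<Rightarrow> nat \<Rightarrow> param \<Rightarrow> (real^2 \<Rightarrow> real) \<Rightarrow> (real^2 \<Rightarrow> real) \<Rightarrow> bool" where
  "subsolution a n p f u \<longleftrightarrow>
     usc_on (network a n) u \<and>
     (\<forall>e\<in>edges a n. \<forall>x\<in>rel_interior e. \<forall>\<phi>.
        test_fun a n p e x \<phi> \<and> local_max_on (network a n) (\<lambda>y. u y - \<phi> y) x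
          \<longrightarrow> \<bar>edge_deriv n p e \<phi> x\<bar> \<le> f x) \<and>
     (\<forall>x\<in>inner_vertices a n. \<forall>e\<in>Inc a n x. \<forall>e'\<in>Inc a n x - {e}. \<forall>\<phi>.
        vertex_test_fun a n p e e' x \<phi> \<and> local_max_on (e \<union> e') (\<lambda>y. u y - \<phi> y) x
          \<longrightarrow> \<bar>edge_deriv n p e \<phi> x\<bar> \<le> f x)"

definition supersolution ::
  "(3 \<Rightarrow> real^2) \<Rightarrow> nat \<Rightarrow> param \<Rightarrow> (real^2 \<Rightarrow> real) \<Rightarrow> (real^2 \<Rightarrow> real) \<Rightarrow> bool" where
  "supersolution a n p f v \<longleftrightarrow>
     lsc_on (network a n) v \<and>
     (\<forall>e\<in>edges a n. \<forall>x\<in>rel_interior e. \<forall>\<phi>.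
        test_fun a n p e x \<phi> \<and> local_min_on (network a n) (\<lambda>y. v y - \<phi> y) x
          \<longrightarrow> \<bar>edge_deriv n p e \<phi> x\<bar> \<ge> f x) \<and>
     (\<forall>x\<in>inner_vertices a n. \<forall>e\<in>Inc a n x. \<exists>e'\<in>Inc a n x - {e}. \<forall>\<phi>.
        vertex_test_fun a n p e e' x \<phi> \<and> local_min_on (e \<union> e') (\<lambda>y. v y - \<phi> y) x
          \<longrightarrow> \<bar>edge_deriv n p e \<phi> x\<bar> \<ge> f x)"

definition viscosity_solution ::
  "(3 \<Rightarrow> real^2) \<Rightarrow> nat \<Rightarrow> param \<Rightarrow> (real^2 \<Rightarrow> real) \<Rightarrow> (real^2 \<Rightarrow> real) \<Rightarrow> bool" where
  "viscosity_solution a n p f u \<longleftrightarrow> subsolution a n p f u \<and> supersolution a n p f u"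

end

theory Submission
  imports Defs
begin

text \<open>Both solutions descend: at an inner vertex \<open>x\<close> the discrete solution equals
  \<open>uh y + h * f x\<close> for some neighbour \<open>y\<close>, and the viscosity solution, which has no local minimum
  at \<open>x\<close> because the constant test function is admissible there, exceeds its value at some neighbour
  \<open>y\<close> by at least \<open>h\<close> times the minimum of \<open>f\<close> on the edge. For every neighbour
  \<open>y\<close> both satisfy the opposite inequality up to \<open>h\<close> times the oscillation of \<open>f\<close> on
  an edge. Following the descent of one solution to the boundary, in at most a constant times \<open>1 / h\<close>
  steps because \<open>f\<close> is bounded below, compares it with the other solution. The same argument, applied
  to the solutions on two levels, shows that \<open>u n\<close> is decreasing in \<open>n\<close> up to an error that
  tends to 0. Together with a Lipschitz bound on the cells of the gasket, this gives the limit.\<close>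

section \<open>Viscosity sub- and supersolutions on an interval\<close>

text \<open>The solutions are compared only through increments between neighbouring vertices. One
  step costs an error of order \<open>h * osc\<close> and lowers the descending function by at least
  \<open>h * fmin\<close>. The factor \<open>h\<close> cancels, so the total error is
  \<open>osc / fmin\<close> times the total drop, up to a factor 2, however many steps are made.
  Strict descent also excludes cycles, so on a finite vertex set it must end in the boundary, where
  the solutions agree.

  The two halves of the viscosity property are not symmetric on an edge. A subsolution is Lipschitz
  in both directions, with an upper bound of \<open>f\<close> as constant; a supersolution may first
  rise from an endpoint, and it is forced down only if this endpoint is not a local minimum on that
  edge.

  The comparison of levels is one-sided for a similar reason: growth bounds survive the subdivision
  of an edge, whereas descent steps on a finer level may leave the coarse vertices. Hence
  near-monotonicity at each vertex takes the place of a Cauchy estimate. Finite ramification then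
  turns Euclidean closeness into closeness of values: nearby cells share a vertex.\<close>

definition interval_subsolution :: "real \<Rightarrow> real \<Rightarrow> (real \<Rightarrow> real) \<Rightarrow> bool" where
  "interval_subsolution h M v \<longleftrightarrow> continuous_on {0..h} v \<and>
     (\<forall>\<psi> \<psi>' t. 0 < t \<longrightarrow> t < h \<longrightarrow> (\<forall>s. (\<psi> has_real_derivative \<psi>' s) (at s)) \<longrightarrow>
        eventually (\<lambda>s. v s - \<psi> s \<le> v t - \<psi> t) (at t) \<longrightarrow> \<bar>\<psi>' t\<bar> \<le> M)"

text \<open>In both notions \<open>f\<close> is replaced by a constant bound on the edge, so that
  explicit barriers can be compared with \<open>v\<close>. The test functions are differentiable on
  the whole line, which makes their transfer to the network independent of the endpoints.\<close>

definition interval_supersolution :: "real \<Rightarrow> real \<Rightarrow> (real \<Rightarrow> real) \<Rightarrow> bool" where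
  "interval_supersolution h m v \<longleftrightarrow> continuous_on {0..h} v \<and>
     (\<forall>\<psi> \<psi>' t. 0 < t \<longrightarrow> t < h \<longrightarrow> (\<forall>s. (\<psi> has_real_derivative \<psi>' s) (at s)) \<longrightarrow>
        eventually (\<lambda>s. v t - \<psi> t \<le> v s - \<psi> s) (at t) \<longrightarrow> m \<le> \<bar>\<psi>' t\<bar>)"

lemma interval_subsolution_slope:
  assumes "interval_subsolution h M v" "0 < t" "t < h" "\<forall>s. (\<psi> has_real_derivative \<psi>' s) (at s)"
    "eventually (\<lambda>s. v s - \<psi> s \<le> v t - \<psi> t) (at t)"
  shows "\<bar>\<psi>' t\<bar> \<le> M"
  using assms(1)[unfolded interval_subsolution_def, THEN conjunct2, THEN spec[of _ \<psi>],
      THEN spec[of _ \<psi>'], THEN spec[of _ t]] assms(2-) by simp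

lemma interval_supersolution_slope:
  assumes "interval_supersolution h m v" "0 < t" "t < h" "\<forall>s. (\<psi> has_real_derivative \<psi>' s) (at s)"
    "eventually (\<lambda>s. v t - \<psi> t \<le> v s - \<psi> s) (at t)"
  shows "m \<le> \<bar>\<psi>' t\<bar>"
  using assms(1)[unfolded interval_supersolution_def, THEN conjunct2, THEN spec[of _ \<psi>],
      THEN spec[of _ \<psi>'], THEN spec[of _ t]] assms(2-) by simp

lemma filterlim_reflect_at:
  fixes h t :: real
  shows "filterlim (\<lambda>s. h - s) (at t) (at (h - t))"
proof (rule filterlim_atI)
  show "((\<lambda>s. h - s) \<longlongrightarrow> t) (at (h - t))"
    by (auto intro!: tendsto_eq_intros)
  show "\<forall>\<^sub>F x in at (h - t). h - x \<noteq> t"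
    by (auto simp: eventually_at_filter)
qed

lemma has_real_derivative_reflect:
  fixes \<psi> \<psi>' :: "real \<Rightarrow> real"
  assumes "\<forall>s. (\<psi> has_real_derivative \<psi>' s) (at s)"
  shows "((\<lambda>s. \<psi> (h - s)) has_real_derivative - \<psi>' (h - s)) (at s)"
proof -
  have "((\<lambda>s. h - s) has_real_derivative - 1) (at s)"
    by (auto intro!: derivative_eq_intros)
  from DERIV_chain2[OF assms[rule_format] this] show ?thesis by simp
qed

text \<open>Reversing the edge only changes the sign of the slope, and the equation sees its
  absolute value. Estimates starting from the left end therefore also hold from the right
  end.\<close>

lemma interval_subsolution_reflect:
  assumes "interval_subsolution h M v"
  shows "interval_subsolution h M (\<lambda>x. v (h - x))"
  unfolding interval_subsolution_def
proof (intro conjI allI impI)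
  show "continuous_on {0..h} (\<lambda>x. v (h - x))"
    by (rule continuous_on_compose2[of "{0..h}" v])
       (use assms in \<open>auto simp: interval_subsolution_def intro!: continuous_intros\<close>)
  fix \<psi> \<psi>' :: "real \<Rightarrow> real" and t :: real
  assume t: "0 < t" "t < h" and der: "\<forall>s. (\<psi> has_real_derivative \<psi>' s) (at s)"
    and max: "\<forall>\<^sub>F s in at t. v (h - s) - \<psi> s \<le> v (h - t) - \<psi> t"
  have "\<forall>\<^sub>F s in at (h - t). v s - \<psi> (h - s) \<le> v (h - t) - \<psi> (h - (h - t))"
    using eventually_compose_filterlim[OF max filterlim_reflect_at[where h = h]] by simp
  then show "\<bar>\<psi>' t\<bar> \<le> M"
    using interval_subsolution_slope[OF assms, of "h - t" "\<lambda>s. \<psi> (h - s)" "\<lambda>s. - \<psi>' (h - s)"]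
      has_real_derivative_reflect[OF der, of h] t by simp
qed

lemma interval_supersolution_reflect:
  assumes "interval_supersolution h m v"
  shows "interval_supersolution h m (\<lambda>x. v (h - x))"
  unfolding interval_supersolution_def
proof (intro conjI allI impI)
  show "continuous_on {0..h} (\<lambda>x. v (h - x))"
    by (rule continuous_on_compose2[of "{0..h}" v])
       (use assms in \<open>auto simp: interval_supersolution_def intro!: continuous_intros\<close>)
  fix \<psi> \<psi>' :: "real \<Rightarrow> real" and t :: real
  assume t: "0 < t" "t < h" and der: "\<forall>s. (\<psi> has_real_derivative \<psi>' s) (at s)"
    and min: "\<forall>\<^sub>F s in at t. v (h - t) - \<psi> t \<le> v (h - s) - \<psi> s"
  have "\<forall>\<^sub>F s in at (h - t). v (h - t) - \<psi> (h - (h - t)) \<le> v s - \<psi> (h - s)"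
    using eventually_compose_filterlim[OF min filterlim_reflect_at[where h = h]] by simp
  then show "m \<le> \<bar>\<psi>' t\<bar>"
    using interval_supersolution_slope[OF assms, of "h - t" "\<lambda>s. \<psi> (h - s)" "\<lambda>s. - \<psi>' (h - s)"]
      has_real_derivative_reflect[OF der, of h] t by simp
qed

text \<open>A line of slope above \<open>M\<close> cannot touch \<open>v\<close> from above inside
  the interval, but the maximum of the difference might sit at \<open>h\<close>, where nothing is
  tested. Adding a high power raises the barrier at \<open>h\<close>; its effect at interior points
  vanishes as the exponent grows.\<close>

lemma viscosity_subsolution_growth:
  fixes v :: "real \<Rightarrow> real"
  assumes v: "interval_subsolution h M v"
    and st: "0 \<le> s" "s < t" "t \<le> h"
  shows "v t \<le> v s + M * (t - s)"
proof -
  have cont: "continuous_on {0..h} v" using v by (simp add: interval_subsolution_def)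
  have steep: "v r \<le> v s + L * (r - s)" if "M < L" and r: "s < r" "r < h" for L r
  proof -
    \<comment> \<open>\<open>D\<close> is the least nonnegative multiple of the power that is sure
      to lift the barrier to at least \<open>v h\<close> at \<open>h\<close>, whatever the sign of
      the gap.\<close>
    define D where "D = \<bar>v h - v s - L * (h - s)\<bar>"
    have bound: "v r \<le> v s + L * (r - s) + D * ((r - s) / (h - s)) ^ Suc k" for k
    proof -
      \<comment> \<open>The exponent \<open>Suc k\<close> makes the added term vanish at
        \<open>s\<close> even for \<open>k = 0\<close>, so the barrier starts exactly at
        \<open>v s\<close>.\<close>
      define \<psi> where "\<psi> = (\<lambda>x. v s + L * (x - s) + D * ((x - s) / (h - s)) ^ Suc k)"
      define \<psi>' where "\<psi>' = (\<lambda>x. L + D * (real (Suc k) * ((x - s) / (h - s)) ^ k * (1 / (h - s))))"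
      have der: "(\<psi> has_real_derivative \<psi>' x) (at x)" for x
        unfolding \<psi>_def \<psi>'_def using r
        by (auto intro!: derivative_eq_intros simp del: power_Suc)
      have "continuous_on {s..h} (\<lambda>x. v x - \<psi> x)"
        using DERIV_isCont[OF der] continuous_on_subset[OF cont, of "{s..h}"] st(1)
      by (intro continuous_on_diff continuous_at_imp_continuous_on[of _ \<psi>]) auto
      then obtain z where z: "z \<in> {s..h}" "\<And>x. x \<in> {s..h} \<Longrightarrow> v x - \<psi> x \<le> v z - \<psi> z"
        using continuous_attains_sup[of "{s..h}" "\<lambda>x. v x - \<psi> x"] r by auto
      have "\<not> (s < z \<and> z < h)"
      proof
        assume zi: "s < z \<and> z < h"
        then have "eventually (\<lambda>x. x \<in> {s<..<h}) (at z)"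
          by (intro eventually_at_in_open') auto
        then have "eventually (\<lambda>x. v x - \<psi> x \<le> v z - \<psi> z) (at z)"
          by eventually_elim (auto intro: z)
        then have "\<bar>\<psi>' z\<bar> \<le> M"
          using interval_subsolution_slope[OF v, of z \<psi> \<psi>'] der zi st(1) by auto
        moreover have "0 \<le> D * (real (Suc k) * ((z - s) / (h - s)) ^ k * (1 / (h - s)))"
          using zi by (intro mult_nonneg_nonneg zero_le_power) (auto simp: D_def)
        then have "L \<le> \<psi>' z" unfolding \<psi>'_def by simp
        ultimately show False
          using \<open>M < L\<close> by linarith
      qed
      then have "z = s \<or> z = h" using z(1) by auto
      then have "v z - \<psi> z \<le> 0"
        using r by (auto simp: \<psi>_def D_def)
      with z(2)[of r] r show ?thesis by (auto simp: \<psi>_def)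
    qed
    have "(\<lambda>k. ((r - s) / (h - s)) ^ Suc k) \<longlonglongrightarrow> 0"
      using r by (intro LIMSEQ_Suc LIMSEQ_realpow_zero) auto
    then have "(\<lambda>k. v s + L * (r - s) + D * ((r - s) / (h - s)) ^ Suc k) \<longlonglongrightarrow> v s + L * (r - s) + D * 0"
      by (intro tendsto_intros)
    then have "v r \<le> v s + L * (r - s) + D * 0"
      by (rule LIMSEQ_le_const) (use bound in blast)
    then show ?thesis by simp
  qed
  have interior: "v r \<le> v s + M * (r - s)" if r: "s < r" "r < h" for r
  proof (rule field_le_epsilon)
    fix e :: real assume "0 < e"
    then show "v r \<le> v s + M * (r - s) + e"
      using steep[of "M + e / (r - s)" r] r by (simp add: distrib_right)
  qed
  show ?thesis
  proof (cases "t < h")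
    case False
    \<comment> \<open>The barrier argument covers only points left of \<open>h\<close>; the endpoint
      follows by continuity from inside.\<close>
    then have [simp]: "t = h" using st by auto
    have cv: "continuous_on {s..h} (\<lambda>r. v s + M * (r - s) - v r)"
      by (intro continuous_intros continuous_on_subset[OF cont]) (use st in auto)
    have nb: "at h within {s<..<h} \<noteq> bot"
      using st islimpt_greaterThanLessThan2[of s h] by (simp add: trivial_limit_within)
    have "((\<lambda>r. v s + M * (r - s) - v r) \<longlongrightarrow> v s + M * (h - s) - v h) (at h within {s<..<h})"
      using cv st by (auto simp: continuous_on_def intro: tendsto_within_subset[of _ _ h "{s..h}"])
    moreover have "eventually (\<lambda>r. 0 \<le> v s + M * (r - s) - v r) (at h within {s<..<h})"
      using interior by (auto simp: eventually_at_filter)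
    ultimately have "0 \<le> v s + M * (h - s) - v h"
      using tendsto_lowerbound nb by blast
    then show ?thesis by simp
  qed (use interior st in auto)
qed

lemma viscosity_subsolution_lipschitz:
  fixes v :: "real \<Rightarrow> real"
  assumes v: "interval_subsolution h M v" and st: "s \<in> {0..h}" "t \<in> {0..h}"
  shows "\<bar>v t - v s\<bar> \<le> M * \<bar>t - s\<bar>"
proof -
  have ord: "\<bar>v y - v x\<bar> \<le> M * (y - x)" if "0 \<le> x" "x < y" "y \<le> h" for x y
  proof -
    have "v y \<le> v x + M * (y - x)"
      by (rule viscosity_subsolution_growth[OF v that])
    moreover have "v (h - (h - x)) \<le> v (h - (h - y)) + M * (h - x - (h - y))"
      by (rule viscosity_subsolution_growth[OF interval_subsolution_reflect[OF v]]) (use that in auto)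
    ultimately show ?thesis by auto
  qed
  consider "s < t" | "t < s" | "s = t" by linarith
  then show ?thesis
    using ord[of s t] ord[of t s] st by cases (auto simp: abs_minus_commute)
qed

text \<open>The test function below has slope above \<open>- m\<close> throughout, but a positive slope at 0: if
  the claimed decrease failed, it would be a lower barrier making 0 a local minimum.\<close>

lemma viscosity_supersolution_descent:
  fixes v :: "real \<Rightarrow> real"
  assumes v: "interval_supersolution h m v"
    and hm: "0 < h" "0 < m"
    and nomin: "\<not> eventually (\<lambda>s. v 0 \<le> v s) (at 0 within {0..h})"
  shows "v h + m * h \<le> v 0"
proof -
  have cont: "continuous_on {0..h} v" using v by (simp add: interval_supersolution_def)
  have le: "v h + m' * h \<le> v 0" if m': "0 < m'" "m' < m" for m'
  proof (rule ccontr)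
    define d where "d = v h + m' * h - v 0"
    \<comment> \<open>The choice gives \<open>d * k = 3/2 * m'\<close>: the barrier below has slopes
      in the interval from \<open>- m'\<close> to \<open>m' / 2\<close>, hence of modulus below
      \<open>m\<close>, and slope \<open>m' / 2\<close> at 0. Here \<open>d\<close> is the amount by
      which the claim fails, so the barrier ends just below \<open>v h\<close>.\<close>
    define k where "k = 3/2 * m' / d"
    assume "\<not> ?thesis"
    then have d: "0 < d" by (simp add: d_def)
    have dk: "d * k = 3/2 * m'" and k: "0 < k" using d m' by (auto simp: k_def)
    define \<psi> where "\<psi> = (\<lambda>x. v 0 - m' * x + d * (1 - exp (- k * x)))"
    define \<psi>' where "\<psi>' = (\<lambda>x. - m' + d * k * exp (- k * x))"
    have der: "(\<psi> has_real_derivative \<psi>' x) (at x)" for x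
      unfolding \<psi>_def \<psi>'_def by (auto intro!: derivative_eq_intros)
    have "continuous_on {0..h} (\<lambda>x. v x - \<psi> x)"
      using DERIV_isCont[OF der]
      by (intro continuous_on_diff cont continuous_at_imp_continuous_on[of _ \<psi>]) auto
    then obtain z where z: "z \<in> {0..h}" "\<And>x. x \<in> {0..h} \<Longrightarrow> v z - \<psi> z \<le> v x - \<psi> x"
      using continuous_attains_inf[of "{0..h}" "\<lambda>x. v x - \<psi> x"] hm by auto
    have "\<not> (0 < z \<and> z < h)"
    proof
      assume zi: "0 < z \<and> z < h"
      then have "eventually (\<lambda>x. x \<in> {0<..<h}) (at z)"
        by (intro eventually_at_in_open') auto
      then have "eventually (\<lambda>x. v z - \<psi> z \<le> v x - \<psi> x) (at z)"
        by eventually_elim (auto intro: z)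
      then have "m \<le> \<bar>\<psi>' z\<bar>"
        using interval_supersolution_slope[OF v, of z \<psi> \<psi>'] der zi by auto
      moreover have "exp (- k * z) \<le> 1" "0 < exp (- k * z)" using k zi by auto
      then have "0 < d * k * exp (- k * z)" "d * k * exp (- k * z) \<le> 3/2 * m'"
        unfolding dk using m' by auto
      ultimately show False
        using m' unfolding \<psi>'_def by linarith
    qed
    then have "z = 0 \<or> z = h" using z(1) by auto
    moreover have "v h - \<psi> h = d * exp (- k * h)" by (simp add: \<psi>_def d_def algebra_simps)
    then have "0 \<le> v h - \<psi> h" using d by simp
    ultimately have "0 \<le> v z - \<psi> z" by (auto simp: \<psi>_def)
    then have barrier: "\<psi> x \<le> v x" if "x \<in> {0..h}" for x using z(2)[OF that] by simp
    have "0 < \<psi>' 0" using m' by (simp add: \<psi>'_def dk)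
    then obtain e where e: "0 < e" "\<And>x. 0 < x \<Longrightarrow> x < e \<Longrightarrow> \<psi> 0 < \<psi> (0 + x)"
      using DERIV_pos_inc_right[OF der] by blast
    have "v 0 \<le> v x" if "x \<in> {0..h}" "x < e" for x
      using barrier[OF that(1)] e(2)[of x] that by (cases "x = 0") (auto simp: \<psi>_def)
    then have "eventually (\<lambda>s. v 0 \<le> v s) (at 0 within {0..h})"
      using e(1) by (auto simp: eventually_at intro!: exI[of _ e])
    with nomin show False by simp
  qed
  show ?thesis
  proof (rule field_le_epsilon)
    fix e :: real assume "0 < e"
    \<comment> \<open>The first entry keeps \<open>m'\<close> positive, the second limits the loss
      \<open>(m - m') * h\<close> to at most \<open>e\<close>.\<close>
    define m' where "m' = max (m / 2) (m - e / h)"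
    have "0 < m'" "m' < m" using hm \<open>0 < e\<close> by (auto simp: m'_def)
    moreover have "m * h \<le> m' * h + e"
    proof -
      have "(m - e / h) * h \<le> m' * h" using hm by (intro mult_right_mono) (auto simp: m'_def)
      moreover have "(m - e / h) * h = m * h - e" using hm by (simp add: left_diff_distrib)
      ultimately show ?thesis by linarith
    qed
    ultimately show "v h + m * h \<le> v 0 + e" using le[of m'] by linarith
  qed
qed

section \<open>Geometry of the prefractals\<close>

lemma word_map_Nil [simp]: "word_map a [] x = x"
  and word_map_Cons [simp]: "word_map a (i # w) x = contraction a i (word_map a w x)"
  and word_map_snoc [simp]: "word_map a (w @ [i]) x = word_map a w (contraction a i x)"
  by (simp_all add: word_map_def)

lemma contraction_fixed [simp]: "contraction a i (a i) = a i"
  by (simp add: contraction_def)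

text \<open>Both sides are the midpoint of \<open>a i\<close> and \<open>a j\<close>. This identity
  is how different cells of one level come to share a vertex.\<close>

lemma contraction_swap: "contraction a i (a j) = contraction a j (a i)"
  by (simp add: contraction_def vec_eq_iff field_simps)

lemma inj_contraction: "inj (contraction a i)"
  by (auto simp: inj_def contraction_def)

lemma contraction_affine:
  "contraction a i ((1 - t) *\<^sub>R x + t *\<^sub>R y) = (1 - t) *\<^sub>R contraction a i x + t *\<^sub>R contraction a i y"
  by (simp add: contraction_def vec_eq_iff field_simps)

lemma word_map_affine:
  "word_map a w ((1 - t) *\<^sub>R x + t *\<^sub>R y) = (1 - t) *\<^sub>R word_map a w x + t *\<^sub>R word_map a w y"
  by (induction w) (simp_all add: contraction_affine)

lemma dist_contraction: "dist (contraction a i x) (contraction a i y) = dist x y / 2"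
proof -
  have "contraction a i x - contraction a i y = (1/2) *\<^sub>R (x - y)"
    by (simp add: contraction_def algebra_simps)
  then show ?thesis by (simp add: dist_norm)
qed

lemma dist_word_map: "dist (word_map a w x) (word_map a w y) = mesh (length w) * dist x y"
  by (induction w) (simp_all add: dist_contraction mesh_def)

lemma word_map_closed_segment:
  "word_map a w ` closed_segment x y = closed_segment (word_map a w x) (word_map a w y)"
  by (simp add: closed_segment_image_interval image_image word_map_affine)

lemma mesh_pos [simp]: "0 < mesh n"
  by (simp add: mesh_def)

lemma mesh_nonneg [simp]: "0 \<le> mesh n"
  and mesh_nonzero [simp]: "mesh n \<noteq> 0"
  by (simp_all add: mesh_def)

lemma mesh_Suc: "mesh (Suc n) = mesh n / 2"
  by (simp add: mesh_def)

lemma mesh_le_1: "mesh n \<le> 1"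
  by (simp add: mesh_def power_le_one)

lemma mesh_tendsto_0: "mesh \<longlonglongrightarrow> 0"
  unfolding mesh_def by (intro LIMSEQ_realpow_zero) auto

lemma vertices_iff: "x \<in> vertices a n \<longleftrightarrow> (\<exists>w i. length w = n \<and> x = word_map a w (a i))"
  by (auto simp: vertices_def)

lemma finite_vertices: "finite (vertices a n)"
  using finite_lists_length_eq[of "UNIV :: 3 set" n] by (auto simp: vertices_def)

lemma vertices_Suc: "vertices a n \<subseteq> vertices a (Suc n)"
proof
  fix x assume "x \<in> vertices a n"
  then obtain w i where "length w = n" "x = word_map a w (a i)" by (auto simp: vertices_iff)
  then have "length (w @ [i]) = Suc n" "x = word_map a (w @ [i]) (a i)" by simp_all
  then show "x \<in> vertices a (Suc n)" unfolding vertices_iff by blast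
qed

lemma vertices_mono: "m \<le> n \<Longrightarrow> vertices a m \<subseteq> vertices a n"
  by (rule lift_Suc_mono_le[of "vertices a"]) (use vertices_Suc in auto)

lemma range_subset_vertices: "range a \<subseteq> vertices a n"
  using vertices_mono[of 0 n a] by (auto simp: vertices_def)

lemma edges_iff:
  "e \<in> edges a n \<longleftrightarrow> (\<exists>w i j. length w = n \<and> i \<noteq> j \<and> e = closed_segment (word_map a w (a i)) (word_map a w (a j)))"
  by (auto simp: edges_def word_map_closed_segment)

text \<open>The two halves of an edge lie in the cells obtained by appending \<open>i\<close> and
  \<open>j\<close>, which meet at its midpoint. This nests the networks and lets estimates on fine
  edges be added up along a coarse one.\<close>

lemma edge_halves:
  assumes "i \<noteq> j"
  shows "closed_segment (word_map a w (a i)) (word_map a w (a j)) =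
    closed_segment (word_map a (w @ [i]) (a i)) (word_map a (w @ [i]) (a j)) \<union>
    closed_segment (word_map a (w @ [j]) (a i)) (word_map a (w @ [j]) (a j))"
proof -
  have "contraction a i (a j) = midpoint (a i) (a j)"
    by (simp add: contraction_def midpoint_def vec_eq_iff field_simps)
  then have "contraction a i (a j) \<in> closed_segment (a i) (a j)" by simp
  then have "closed_segment (a i) (a j) =
      closed_segment (a i) (contraction a i (a j)) \<union> closed_segment (contraction a i (a j)) (a j)"
    by (simp add: Un_closed_segment)
  then show ?thesis
    by (simp flip: word_map_closed_segment image_Un add: contraction_swap[of a j i])
qed

lemma network_Suc: "network a n \<subseteq> network a (Suc n)"
proof
  fix x assume "x \<in> network a n"
  then obtain w i j where w: "length w = n" "i \<noteq> j"
    and x: "x \<in> closed_segment (word_map a w (a i)) (word_map a w (a j))"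
    by (auto simp: network_def edges_iff)
  let ?h = "\<lambda>k. closed_segment (word_map a (w @ [k]) (a i)) (word_map a (w @ [k]) (a j))"
  have "?h k \<in> edges a (Suc n)" for k
    unfolding edges_iff using w by (intro exI[of _ "w @ [k]"] exI[of _ i] exI[of _ j]) simp
  moreover have "x \<in> ?h i \<union> ?h j" using x edge_halves[OF w(2)] by blast
  ultimately show "x \<in> network a (Suc n)" unfolding network_def by blast
qed

lemma network_mono: "m \<le> n \<Longrightarrow> network a m \<subseteq> network a n"
  by (rule lift_Suc_mono_le[of "network a"]) (use network_Suc in auto)

lemma vertices_subset_network: "vertices a n \<subseteq> network a n"
proof
  fix x assume "x \<in> vertices a n"
  then obtain w i where w: "length w = n" "x = word_map a w (a i)" by (auto simp: vertices_iff)
  have "i \<noteq> i + 1" using exhaust_3[of i] by auto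
  then obtain j where "i \<noteq> j" by blast
  then have "closed_segment (word_map a w (a i)) (word_map a w (a j)) \<in> edges a n"
    using w unfolding edges_iff by blast
  then show "x \<in> network a n" using w unfolding network_def by auto
qed

lemma vertices_subset_gasket: "vertices a n \<subseteq> gasket a"
  unfolding gasket_def by (rule order_trans[OF _ closure_subset]) blast

text \<open>Adjacency mentions only the segment; a segment determines its pair of endpoints, up to
  order, and \<open>i\<close> and \<open>j\<close> are exchanged when the order is reversed.\<close>

lemma adjD:
  assumes "adj a n x y"
  obtains w i j where "length w = n" "i \<noteq> j" "x = word_map a w (a i)" "y = word_map a w (a j)"
    "closed_segment x y \<in> edges a n"
proof -
  from assms obtain w i j where w: "length w = n" "i \<noteq> j"
    and e: "closed_segment x y \<in> edges a n" "closed_segment x y = closed_segment (word_map a w (a i)) (word_map a w (a j))"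
    unfolding adj_def edges_iff by blast
  then have "{x, y} = {word_map a w (a i), word_map a w (a j)}" by simp
  then consider "x = word_map a w (a i)" "y = word_map a w (a j)"
    | "x = word_map a w (a j)" "y = word_map a w (a i)"
    by (auto simp: doubleton_eq_iff)
  then show ?thesis
  proof cases
    case 1
    then show ?thesis by (intro that[of w i j] w e(1))
  next
    case 2
    then show ?thesis by (intro that[of w j i] w(1) w(2)[symmetric] e(1))
  qed
qed

lemma adjI:
  assumes "length w = n" "i \<noteq> j"
  shows "adj a n (word_map a w (a i)) (word_map a w (a j))"
  using assms unfolding adj_def vertices_iff edges_iff by blast

lemma adj_sym: "adj a n x y \<Longrightarrow> adj a n y x"
  by (simp add: adj_def closed_segment_commute)

section \<open>Lengths of curves and the geodesic distance\<close>

lemma curve_length_linepath: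
  fixes x y :: "'a::real_normed_vector"
  shows "curve_length (linepath x y) \<le> ennreal (dist x y)"
  unfolding curve_length_def
proof (rule SUP_least, rule ennreal_leI, clarify)
  fix ts :: "real list" assume ts: "sorted ts" "set ts \<subseteq> {0..1}"
  show "(\<Sum>i<length ts - 1. dist (linepath x y (ts ! i)) (linepath x y (ts ! Suc i))) \<le> dist x y"
  proof (cases "ts = []")
    case False
    have *: "dist (linepath x y s) (linepath x y t) = \<bar>t - s\<bar> * dist x y" for s t
    proof -
      have "linepath x y s - linepath x y t = (t - s) *\<^sub>R (x - y)"
        by (simp add: linepath_def algebra_simps)
      then show ?thesis by (simp add: dist_norm)
    qed
    have "(\<Sum>i<length ts - 1. dist (linepath x y (ts ! i)) (linepath x y (ts ! Suc i))) =
        (\<Sum>i<length ts - 1. (ts ! Suc i - ts ! i) * dist x y)"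
      unfolding * using ts(1) by (intro sum.cong refl) (auto simp: sorted_nth_mono)
    also have "\<dots> = (ts ! (length ts - 1) - ts ! 0) * dist x y"
      by (simp add: sum_lessThan_telescope flip: sum_distrib_right)
    also have "\<dots> \<le> 1 * dist x y"
    proof (rule mult_right_mono)
      have "ts ! (length ts - 1) \<in> {0..1}" "ts ! 0 \<in> {0..1}"
        using False by (auto intro!: subsetD[OF ts(2)] simp del: atLeastAtMost_iff)
      then show "ts ! (length ts - 1) - ts ! 0 \<le> 1" by simp
    qed simp
    finally show ?thesis by simp
  qed simp
qed

lemma geodesic_dist_le_segment:
  fixes x y :: "'a::real_normed_vector"
  assumes "closed_segment x y \<subseteq> X"
  shows "geodesic_dist X x y \<le> ennreal (dist x y)"
  unfolding geodesic_dist_def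
  by (rule INF_lower2[of "linepath x y"]) (use assms curve_length_linepath in auto)

text \<open>The chord is already an inscribed polygon. This lets Euclidean uniform continuity of
  \<open>f\<close> control the geodesic modulus.\<close>

lemma dist_le_geodesic_dist: "ennreal (dist x y) \<le> geodesic_dist X x y"
  unfolding geodesic_dist_def
proof (rule INF_greatest)
  fix \<gamma> :: "real \<Rightarrow> 'a" assume "\<gamma> \<in> {\<gamma>. path \<gamma> \<and> path_image \<gamma> \<subseteq> X \<and> pathstart \<gamma> = x \<and> pathfinish \<gamma> = y}"
  then have "\<gamma> 0 = x" "\<gamma> 1 = y" by (auto simp: pathstart_def pathfinish_def)
  then show "ennreal (dist x y) \<le> curve_length \<gamma>"
    unfolding curve_length_def by (intro SUP_upper2[of "[0, 1]"]) auto
qed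

section \<open>Barycentric coordinates, cells and their intersections\<close>

locale unit_triangle =
  fixes a :: "3 \<Rightarrow> real^2"
  assumes unit_dist: "\<And>i j. i \<noteq> j \<Longrightarrow> dist (a i) (a j) = 1"
begin

definition center :: "real^2" where
  "center = (1/3) *\<^sub>R (a 1 + a 2 + a 3)"

text \<open>These are the barycentric coordinates. In a unit equilateral triangle the vectors from
  the centroid to the vertices have squared length 1/3 and mutual inner products - 1/6, which fixes
  the constants 1/3 and 2.\<close>

definition bary :: "3 \<Rightarrow> real^2 \<Rightarrow> real" where
  "bary i x = 1/3 + 2 * ((x - center) \<bullet> (a i - center))"

abbreviation triangle :: "(real^2) set" where
  "triangle \<equiv> convex hull (range a)"

abbreviation cell :: "3 list \<Rightarrow> (real^2) set" where
  "cell w \<equiv> word_map a w ` triangle"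

lemma bary_vertex: "bary i (a j) = (if i = j then 1 else 0)"
proof -
  define b where "b = (\<lambda>i. a i - center)"
  \<comment> \<open>The zero sum and the three unit side lengths give a linear system that
    determines all six inner products.\<close>
  have zero: "b 1 + b 2 + b 3 = 0"
    by (simp add: b_def center_def vec_eq_iff field_simps)
  have "b i \<bullet> (b 1 + b 2 + b 3) = 0" for i unfolding zero by simp
  then have s: "b i \<bullet> b 1 + b i \<bullet> b 2 + b i \<bullet> b 3 = 0" for i by (simp add: inner_add_right)
  have d: "b i \<bullet> b i + b j \<bullet> b j - 2 * (b i \<bullet> b j) = 1" if "i \<noteq> j" for i j
  proof -
    have "(b i - b j) \<bullet> (b i - b j) = 1"
      using unit_dist[OF that] by (simp add: b_def dist_norm flip: power2_norm_eq_inner)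
    then show ?thesis by (simp add: inner_diff_left inner_diff_right inner_commute)
  qed
  have d': "b 1 \<bullet> b 1 + b 2 \<bullet> b 2 - 2 * (b 1 \<bullet> b 2) = 1" "b 1 \<bullet> b 1 + b 3 \<bullet> b 3 - 2 * (b 1 \<bullet> b 3) = 1"
    "b 2 \<bullet> b 2 + b 3 \<bullet> b 3 - 2 * (b 2 \<bullet> b 3) = 1"
    by (rule d; simp)+
  have comm: "b 2 \<bullet> b 1 = b 1 \<bullet> b 2" "b 3 \<bullet> b 1 = b 1 \<bullet> b 3" "b 3 \<bullet> b 2 = b 2 \<bullet> b 3"
    by (simp_all add: inner_commute)
  note s' = s[of 1] s[of 2, unfolded comm] s[of 3, unfolded comm]
  have "b 1 \<bullet> b 1 = 1/3" "b 2 \<bullet> b 2 = 1/3" "b 3 \<bullet> b 3 = 1/3"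
    "b 1 \<bullet> b 2 = - 1/6" "b 1 \<bullet> b 3 = - 1/6" "b 2 \<bullet> b 3 = - 1/6"
    using s' d' by linarith+
  then have "b i \<bullet> b j = (if i = j then 1/3 else - 1/6)"
    using comm exhaust_3[of i] exhaust_3[of j] by (elim disjE) simp_all
  then show ?thesis by (simp add: bary_def b_def inner_commute)
qed

lemma bary_affine:
  assumes "s + t = 1"
  shows "bary i (s *\<^sub>R x + t *\<^sub>R y) = s * bary i x + t * bary i y"
proof -
  have t: "t = 1 - s" using assms by simp
  have "s *\<^sub>R x + t *\<^sub>R y - center = s *\<^sub>R (x - center) + t *\<^sub>R (y - center)"
    by (simp add: t algebra_simps)
  then have "bary i (s *\<^sub>R x + t *\<^sub>R y) = (s + t) / 3 + 2 * (s * ((x - center) \<bullet> (a i - center)) + t * ((y - center) \<bullet> (a i - center)))"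
    using assms by (simp add: bary_def inner_add_left)
  then show ?thesis by (simp add: bary_def algebra_simps add_divide_distrib)
qed

lemma bary_sum: "bary 1 x + bary 2 x + bary 3 x = 1"
proof -
  have "(a 1 - center) + (a 2 - center) + (a 3 - center) = 0"
    by (simp add: center_def vec_eq_iff field_simps)
  then have "(x - center) \<bullet> ((a 1 - center) + (a 2 - center) + (a 3 - center)) = 0" by (simp only: inner_zero_right)
  then show ?thesis by (simp only: bary_def inner_add_right)
qed

text \<open>The points with both properties form a convex set containing the vertices, hence contain
  the hull. The reconstruction formula is what identifies a point from its coordinates.\<close>

lemma triangle_bary:
  assumes "x \<in> triangle"
  shows "0 \<le> bary i x" and "x = bary 1 x *\<^sub>R a 1 + bary 2 x *\<^sub>R a 2 + bary 3 x *\<^sub>R a 3"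
proof -
  let ?P = "{x. (\<forall>i. 0 \<le> bary i x) \<and> x = bary 1 x *\<^sub>R a 1 + bary 2 x *\<^sub>R a 2 + bary 3 x *\<^sub>R a 3}"
  have "triangle \<subseteq> ?P"
  proof (rule hull_minimal)
    show "range a \<subseteq> ?P"
    proof clarify
      fix j show "(\<forall>i. 0 \<le> bary i (a j)) \<and> a j = bary 1 (a j) *\<^sub>R a 1 + bary 2 (a j) *\<^sub>R a 2 + bary 3 (a j) *\<^sub>R a 3"
        using exhaust_3[of j] by (auto simp: bary_vertex)
    qed
    show "convex ?P"
    proof (rule convexI, clarify)
      fix x y and u v :: real
      assume uv: "0 \<le> u" "0 \<le> v" "u + v = 1"
        and x: "\<forall>i. 0 \<le> bary i x" "x = bary 1 x *\<^sub>R a 1 + bary 2 x *\<^sub>R a 2 + bary 3 x *\<^sub>R a 3"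
        and y: "\<forall>i. 0 \<le> bary i y" "y = bary 1 y *\<^sub>R a 1 + bary 2 y *\<^sub>R a 2 + bary 3 y *\<^sub>R a 3"
      have b: "bary i (u *\<^sub>R x + v *\<^sub>R y) = u * bary i x + v * bary i y" for i
        by (rule bary_affine[OF uv(3)])
      have "(u * bary 1 x + v * bary 1 y) *\<^sub>R a 1 + (u * bary 2 x + v * bary 2 y) *\<^sub>R a 2 + (u * bary 3 x + v * bary 3 y) *\<^sub>R a 3 =
          u *\<^sub>R (bary 1 x *\<^sub>R a 1 + bary 2 x *\<^sub>R a 2 + bary 3 x *\<^sub>R a 3) +
          v *\<^sub>R (bary 1 y *\<^sub>R a 1 + bary 2 y *\<^sub>R a 2 + bary 3 y *\<^sub>R a 3)"
        by (simp add: algebra_simps)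
      also have "\<dots> = u *\<^sub>R x + v *\<^sub>R y" by (simp only: x(2)[symmetric] y(2)[symmetric])
      finally show "(\<forall>i. 0 \<le> bary i (u *\<^sub>R x + v *\<^sub>R y)) \<and> u *\<^sub>R x + v *\<^sub>R y =
          bary 1 (u *\<^sub>R x + v *\<^sub>R y) *\<^sub>R a 1 + bary 2 (u *\<^sub>R x + v *\<^sub>R y) *\<^sub>R a 2 + bary 3 (u *\<^sub>R x + v *\<^sub>R y) *\<^sub>R a 3"
        unfolding b using uv x(1) y(1) by simp
    qed
  qed
  with assms show "0 \<le> bary i x" "x = bary 1 x *\<^sub>R a 1 + bary 2 x *\<^sub>R a 2 + bary 3 x *\<^sub>R a 3" by auto
qed

lemma triangle_bary_le_1: "x \<in> triangle \<Longrightarrow> bary i x \<le> 1"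
  using triangle_bary(1)[of x 1] triangle_bary(1)[of x 2] triangle_bary(1)[of x 3]
    bary_sum[of x] exhaust_3[of i] by auto

lemma triangle_bary_eq_1:
  assumes "x \<in> triangle" "bary i x = 1"
  shows "x = a i"
proof -
  have "bary j x = (if j = i then 1 else 0)" for j
    using triangle_bary(1)[OF assms(1), of 1] triangle_bary(1)[OF assms(1), of 2]
      triangle_bary(1)[OF assms(1), of 3] bary_sum[of x] assms(2) exhaust_3[of i] exhaust_3[of j]
    by (elim disjE) simp_all
  then show ?thesis
    using triangle_bary(2)[OF assms(1)] exhaust_3[of i] by auto
qed

lemma bary_contraction: "bary j (contraction a i x) = (if i = j then 1/2 else 0) + bary j x / 2"
proof -
  have "contraction a i x = (1/2) *\<^sub>R a i + (1/2) *\<^sub>R x"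
    by (simp add: contraction_def vec_eq_iff field_simps)
  then show ?thesis by (simp add: bary_affine bary_vertex)
qed

lemma contraction_in_triangle:
  assumes "x \<in> triangle"
  shows "contraction a i x \<in> triangle"
proof -
  have "contraction a i x = (1 - 1/2) *\<^sub>R a i + (1/2) *\<^sub>R x"
    by (simp add: contraction_def vec_eq_iff field_simps)
  then show ?thesis
    using convexD_alt[OF convex_convex_hull hull_inc[of "a i" "range a"] assms, of "1/2"] by simp
qed

lemma cell_subset_triangle: "cell w \<subseteq> triangle"
  by (induction w) (auto simp: contraction_in_triangle)

text \<open>Coordinate \<open>j\<close> is at most 1/2 after a contraction towards another vertex,
  so the first letter must be \<open>j\<close>; as \<open>a j\<close> is fixed by this contraction,
  the letter can be removed.\<close>

lemma vertex_in_cell: "a j \<in> cell w \<Longrightarrow> a j \<in> word_map a w ` range a"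
proof (induction w)
  case (Cons i w)
  then obtain y where y: "y \<in> cell w" "a j = contraction a i y" by auto
  then have yt: "y \<in> triangle" using cell_subset_triangle by blast
  have le: "bary j y \<le> 1" using triangle_bary_le_1[OF yt] .
  have "1 = (if i = j then 1/2 else 0) + bary j y / 2"
    using bary_vertex[of j j] bary_contraction[of j i y] y(2) by simp
  with le have "i = j" "bary j y = 1" by (auto split: if_splits)
  then have "y = a j" using triangle_bary_eq_1 yt by blast
  with Cons.IH y(1) have "a j \<in> word_map a w ` range a" by simp
  then obtain k where k: "a j = word_map a w (a k)" by auto
  have "word_map a (i # w) (a k) = a j" by (simp add: \<open>i = j\<close> k[symmetric])
  then show ?case by (metis rangeI imageI)
qed auto

text \<open>The gasket is finitely ramified: cells with different first letters \<open>i\<close> and \<open>j\<close> can meet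
  only in the midpoint of \<open>a i\<close> and \<open>a j\<close>.\<close>

lemma cells_meet:
  assumes "length w = length w'" "cell w \<inter> cell w' \<noteq> {}"
  shows "\<exists>i j. word_map a w (a i) = word_map a w' (a j)"
  using assms
proof (induction w w' rule: list_induct2)
  case (Cons i w j w')
  from Cons.prems obtain y z where y: "y \<in> cell w" and z: "z \<in> cell w'"
    and eq: "contraction a i y = contraction a j z" by auto
  show ?case
  proof (cases "i = j")
    case True
    then have "y = z" using eq inj_contraction[of a i] by (auto simp: inj_def)
    with y z Cons.IH obtain k l where "word_map a w (a k) = word_map a w' (a l)" by blast
    then show ?thesis using True by (metis word_map_Cons)
  next
    case False
    have yt: "y \<in> triangle" and zt: "z \<in> triangle" using y z cell_subset_triangle by blast+
    have b: "(if i = k then 1/2 else 0) + bary k y / 2 = (if j = k then 1/2 else 0) + bary k z / 2" for k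
      using bary_contraction[of k i y] bary_contraction[of k j z] eq by simp
    \<comment> \<open>Equation \<open>b\<close> at \<open>j\<close> reads
      \<open>bary j y = 1 + bary j z\<close>, and all coordinates lie between 0 and 1; the same
      holds at \<open>i\<close> with \<open>y\<close> and \<open>z\<close> exchanged.\<close>
    have "bary j y = 1" "bary i z = 1"
      using b[of i] b[of j] False triangle_bary(1)[OF yt, of i] triangle_bary(1)[OF zt, of j]
        triangle_bary_le_1[OF yt, of j] triangle_bary_le_1[OF zt, of i] by auto
    then have "y = a j" "z = a i" using triangle_bary_eq_1 yt zt by auto
    with vertex_in_cell[of j w] vertex_in_cell[of i w'] y z
    have "a j \<in> word_map a w ` range a" "a i \<in> word_map a w' ` range a" by simp_all
    then obtain k l where "a j = word_map a w (a k)" "a i = word_map a w' (a l)" by auto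
    then have "word_map a (i # w) (a k) = contraction a i (a j)" "word_map a (j # w') (a l) = contraction a j (a i)"
      by simp_all
    then show ?thesis using contraction_swap by metis
  qed
qed auto

text \<open>Each contraction halves the coordinates and adds 0 or 1/2; after scaling by
  \<open>2 ^ length w\<close> the added terms are integers. So the fractional part of a scaled
  coordinate does not depend on the word.\<close>

lemma bary_word_map: "\<exists>c\<in>\<int>. bary k (word_map a w x) * 2 ^ length w = c + bary k x"
proof (induction w)
  case (Cons i w)
  then obtain c where c: "c \<in> \<int>" "bary k (word_map a w x) * 2 ^ length w = c + bary k x" by blast
  have "bary k (word_map a (i # w) x) * 2 ^ length (i # w) =
      (if i = k then 2 ^ length w else 0) + bary k (word_map a w x) * 2 ^ length w"
    by (simp add: bary_contraction algebra_simps)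
  then show ?case using c by (intro bexI[of _ "(if i = k then 2 ^ length w else 0) + c"]) auto
qed auto

text \<open>The scaled coordinate \<open>j\<close> is an integer at a vertex, and an integer plus
  \<open>t\<close> at the point of the edge with parameter \<open>t\<close>. Thus an edge through a
  vertex has this vertex as an endpoint.\<close>

lemma vertex_on_edge:
  assumes x: "x \<in> vertices a n" and w: "length w = n" "i \<noteq> j"
    and xe: "x \<in> closed_segment (word_map a w (a i)) (word_map a w (a j))"
  shows "x = word_map a w (a i) \<or> x = word_map a w (a j)"
proof -
  obtain t where t: "0 \<le> t" "t \<le> 1" "x = (1 - t) *\<^sub>R word_map a w (a i) + t *\<^sub>R word_map a w (a j)"
    using xe by (auto simp: closed_segment_def)
  then have xt: "x = word_map a w ((1 - t) *\<^sub>R a i + t *\<^sub>R a j)" by (simp add: word_map_affine)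
  obtain c where c: "c \<in> \<int>" "bary j x * 2 ^ n = c + bary j ((1 - t) *\<^sub>R a i + t *\<^sub>R a j)"
    using bary_word_map[of j w] w(1) unfolding xt by blast
  obtain w' k where w': "length w' = n" "x = word_map a w' (a k)" using x by (auto simp: vertices_iff)
  obtain c' where c': "c' \<in> \<int>" "bary j x * 2 ^ n = c' + bary j (a k)"
    using bary_word_map[of j w' "a k"] w' by blast
  have "bary j ((1 - t) *\<^sub>R a i + t *\<^sub>R a j) = t"
    using w(2) by (simp add: bary_affine bary_vertex)
  then have "t = c' + (if j = k then 1 else 0) - c" using c c' by (simp add: bary_vertex)
  then have "t \<in> \<int>" using c(1) c'(1) by auto
  then obtain z where "t = of_int z" by (auto elim: Ints_cases)
  with t have "t = 0 \<or> t = 1" by auto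
  with t show ?thesis by auto
qed

section \<open>Compactness, and the networks inside the gasket\<close>

lemma compact_triangle: "compact triangle"
  by (intro compact_convex_hull finite_imp_compact) auto

lemma compact_cell: "compact (cell w)"
proof (rule compact_continuous_image[OF _ compact_triangle])
  show "continuous_on triangle (word_map a w)"
  proof (rule continuous_onI)
    fix x and e :: real assume "0 < e"
    have "dist (word_map a w y) (word_map a w x) \<le> dist y x" for y
      using mult_left_le_one_le[of "dist y x" "mesh (length w)"] mesh_le_1[of "length w"]
        mesh_pos[of "length w"] by (simp add: dist_word_map)
    then show "\<exists>d>0. \<forall>y\<in>triangle. dist y x < d \<longrightarrow> dist (word_map a w y) (word_map a w x) \<le> e"
      using \<open>0 < e\<close> by (intro exI[of _ e]) (meson less_imp_le order_trans)
  qed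
qed

lemma compact_gasket: "compact (gasket a)"
proof -
  have "vertices a n \<subseteq> triangle" for n
    using cell_subset_triangle hull_inc[of _ "range a"] by (fastforce simp: vertices_iff)
  then have "gasket a \<subseteq> triangle"
    unfolding gasket_def by (intro closure_minimal compact_imp_closed compact_triangle) blast
  then show ?thesis
    using compact_triangle bounded_subset compact_imp_bounded
    by (auto simp: compact_eq_bounded_closed gasket_def)
qed

lemma dist_edge_ends:
  "length w = n \<Longrightarrow> i \<noteq> j \<Longrightarrow> dist (word_map a w (a i)) (word_map a w (a j)) = mesh n"
  by (simp add: dist_word_map unit_dist)

lemma dist_in_edge:
  assumes "e \<in> edges a n" "x \<in> e" "y \<in> e"
  shows "dist x y \<le> mesh n"
proof -
  obtain w i j where w: "length w = n" "i \<noteq> j" "e = closed_segment (word_map a w (a i)) (word_map a w (a j))"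
    using assms(1) edges_iff by blast
  obtain s t where st: "0 \<le> s" "s \<le> 1" "0 \<le> t" "t \<le> 1"
    "x = word_map a w ((1 - s) *\<^sub>R a i + s *\<^sub>R a j)" "y = word_map a w ((1 - t) *\<^sub>R a i + t *\<^sub>R a j)"
    using assms(2,3) unfolding w(3) closed_segment_def by (auto simp: word_map_affine)
  have "((1 - s) *\<^sub>R a i + s *\<^sub>R a j) - ((1 - t) *\<^sub>R a i + t *\<^sub>R a j) = (t - s) *\<^sub>R (a i - a j)"
    by (simp add: algebra_simps)
  then have "dist ((1 - s) *\<^sub>R a i + s *\<^sub>R a j) ((1 - t) *\<^sub>R a i + t *\<^sub>R a j) = \<bar>t - s\<bar>"
    using unit_dist[OF w(2)] by (simp add: dist_norm)
  then show ?thesis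
    using st w(1) mult_right_le_one_le[of "mesh n" "\<bar>t - s\<bar>"] by (simp add: dist_word_map less_imp_le abs_le_iff)
qed

text \<open>A point of an edge stays on some edge of every finer level, so it is within
  \<open>mesh m\<close> of a vertex for each large \<open>m\<close>.\<close>

lemma network_subset_gasket: "network a n \<subseteq> gasket a"
proof
  fix x assume x: "x \<in> network a n"
  show "x \<in> gasket a"
    unfolding gasket_def closure_approachable
  proof (intro allI impI)
    fix \<epsilon> :: real assume "0 < \<epsilon>"
    then have "eventually (\<lambda>m. mesh m < \<epsilon>) sequentially" by (rule order_tendstoD(2)[OF mesh_tendsto_0])
    then obtain m where m: "n \<le> m" "mesh m < \<epsilon>" unfolding eventually_sequentially by (meson linear)
    have "x \<in> network a m" using x network_mono[OF m(1)] by blast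
    then obtain e where e: "e \<in> edges a m" "x \<in> e" by (auto simp: network_def)
    then obtain w i j where w: "length w = m" "e = closed_segment (word_map a w (a i)) (word_map a w (a j))"
      using edges_iff by blast
    have "word_map a w (a i) \<in> (\<Union>n. vertices a n)" using w(1) vertices_iff by blast
    moreover have "dist (word_map a w (a i)) x < \<epsilon>"
      using dist_in_edge[OF e(1), of "word_map a w (a i)" x] e(2) w(2) m(2) by auto
    ultimately show "\<exists>y\<in>\<Union>n. vertices a n. dist y x < \<epsilon>" by blast
  qed
qed

end

section \<open>Viscosity solutions on the edges\<close>

lemma usc_lsc_continuous_on:
  assumes "usc_on X u" "lsc_on X u"
  shows "continuous_on X u"
  unfolding continuous_on_def
proof
  fix x assume "x \<in> X"
  with assms show "(u \<longlongrightarrow> u x) (at x within X)"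
    by (intro order_tendstoI) (auto simp: usc_on_def lsc_on_def)
qed

lemma convex_edge: "e \<in> edges a n \<Longrightarrow> convex e"
  and closed_edge: "e \<in> edges a n \<Longrightarrow> closed e"
  and edge_nonempty: "e \<in> edges a n \<Longrightarrow> e \<noteq> {}"
  by (auto simp: edges_iff)

context
  fixes a :: "3 \<Rightarrow> real^2" and n :: nat and p :: param and e :: "(real^2) set"
  assumes params: "arc_length_params a n p" and e: "e \<in> edges a n"
begin

lemma param_image: "p e ` {0..mesh n} = e"
  and param_isometry: "s \<in> {0..mesh n} \<Longrightarrow> t \<in> {0..mesh n} \<Longrightarrow> dist (p e s) (p e t) = \<bar>s - t\<bar>"
  using params e by (auto simp: arc_length_params_def)

lemma param_inj: "inj_on (p e) {0..mesh n}"
  by (rule inj_onI) (metis abs_eq_0 dist_self param_isometry right_minus_eq)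

lemma param_inv_param: "t \<in> {0..mesh n} \<Longrightarrow> param_inv n p e (p e t) = t"
  by (simp add: param_inv_def the_inv_into_f_f param_inj)

lemma
  assumes "x \<in> e"
  shows param_inv_in: "param_inv n p e x \<in> {0..mesh n}"
    and param_param_inv: "p e (param_inv n p e x) = x"
proof -
  obtain t where "t \<in> {0..mesh n}" "x = p e t" using assms param_image by blast
  then show "param_inv n p e x \<in> {0..mesh n}" "p e (param_inv n p e x) = x"
    using param_inv_param by simp_all
qed

lemma dist_param_inv: "x \<in> e \<Longrightarrow> y \<in> e \<Longrightarrow> dist (param_inv n p e x) (param_inv n p e y) = dist x y"
  using param_isometry[of "param_inv n p e x" "param_inv n p e y"] param_inv_in param_param_inv
  by (simp add: dist_real_def)

lemma continuous_on_param_inv: "continuous_on e (param_inv n p e)"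
  by (rule continuous_onI) (auto simp: dist_param_inv intro: less_imp_le)

lemma continuous_on_param: "continuous_on {0..mesh n} (p e)"
  by (rule continuous_onI) (auto simp: param_isometry dist_real_def intro: less_imp_le)

lemma edge_subset_network: "e \<subseteq> network a n"
  using e by (auto simp: network_def)

text \<open>A test function on the edge is extended to the network as \<open>u - (u - \<psi>) \<circ> \<rho>\<close> with a
  retraction \<open>\<rho>\<close> onto the edge, which keeps the extremum of \<open>u - \<psi>\<close> and requires no
  information on how the edges intersect.\<close>

lemma edge_test_function:
  assumes u: "continuous_on (network a n) u" and t: "0 < t" "t < mesh n"
    and der: "\<forall>s. (\<psi> has_real_derivative \<psi>' s) (at s)"
  obtains \<phi> r where "test_fun a n p e (p e t) \<phi>" "edge_deriv n p e \<phi> (p e t) = \<psi>' t"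
    "filterlim r (nhds t) (at (p e t) within network a n)" "r (p e t) = t"
    "\<And>y. u y - \<phi> y = u (p e (r y)) - \<psi> (r y)"
proof -
  \<comment> \<open>The edge is convex and closed, so the closest point is a continuous retraction;
    \<open>r\<close> is the parameter of that point.\<close>
  define r where "r = (\<lambda>y. param_inv n p e (closest_point e y))"
  define \<phi> where "\<phi> = (\<lambda>y. u y - (u (p e (r y)) - \<psi> (r y)))"
  note ce = convex_edge[OF e] closed_edge[OF e] edge_nonempty[OF e]
  have r_in: "r y \<in> {0..mesh n}" for y
    unfolding r_def using ce by (intro param_inv_in closest_point_in_set)
  have r_param: "r (p e s) = s" if "s \<in> {0..mesh n}" for s
  proof -
    have "p e s \<in> e" using that param_image by blast
    then show ?thesis using that by (simp add: r_def closest_point_self param_inv_param)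
  qed
  have cont_r: "continuous_on A r" for A
    unfolding r_def
    by (rule continuous_on_compose2[OF continuous_on_param_inv continuous_on_closest_point])
       (use ce in \<open>auto intro: closest_point_in_set\<close>)
  have cont_pr: "continuous_on A (\<lambda>y. p e (r y))" for A
    by (rule continuous_on_compose2[OF continuous_on_param cont_r]) (use r_in in auto)
  have cont_upr: "continuous_on A (\<lambda>y. u (p e (r y)))" for A
    by (rule continuous_on_compose2[OF u cont_pr])
       (use r_in param_image edge_subset_network in blast)
  have cont_\<psi>: "continuous_on UNIV \<psi>"
    using der DERIV_isCont by (intro continuous_at_imp_continuous_on) auto
  have "continuous_on (network a n) \<phi>"
    unfolding \<phi>_def
    by (intro continuous_intros u cont_upr continuous_on_compose2[OF cont_\<psi> cont_r]) auto
  \<comment> \<open>On the edge the retraction is the identity and the two values of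
    \<open>u\<close> cancel, so differentiability of \<open>u\<close> itself does not enter.\<close>
  have eq: "(\<phi> \<circ> p e) s = \<psi> s" if "s \<in> {0..mesh n}" for s
    using that by (simp add: \<phi>_def r_param)
  have tI: "t \<in> {0..mesh n}" using t by auto
  have "(\<psi> has_vector_derivative \<psi>' t) (at t within {0..mesh n})"
    using der by (simp add: has_real_derivative_iff_has_vector_derivative has_vector_derivative_at_within)
  then have vd: "(\<phi> \<circ> p e has_vector_derivative \<psi>' t) (at t within {0..mesh n})"
    by (rule has_vector_derivative_transform[OF tI, rotated]) (use eq in auto)
  then have "test_fun a n p e (p e t) \<phi>"
    using \<open>continuous_on (network a n) \<phi>\<close> tI
    by (auto simp: test_fun_def edge_differentiable_def param_inv_param intro: differentiableI_vector)
  moreover have "edge_deriv n p e \<phi> (p e t) = \<psi>' t"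
    using vector_derivative_within_closed_interval[OF _ _ vd] t tI
    by (simp add: edge_deriv_def param_inv_param)
  moreover have "filterlim r (nhds t) (at (p e t) within network a n)"
  proof -
    have "p e t \<in> network a n" using param_image tI edge_subset_network by blast
    then show ?thesis using cont_r[of "network a n"] r_param[OF tI] by (auto simp: continuous_on_def)
  qed
  moreover have "u y - \<phi> y = u (p e (r y)) - \<psi> (r y)" for y by (simp add: \<phi>_def)
  ultimately show ?thesis using that r_param[OF tI] by blast
qed

lemma continuous_on_edge_param:
  assumes "continuous_on (network a n) u"
  shows "continuous_on {0..mesh n} (\<lambda>s. u (p e s))"
  by (rule continuous_on_compose2[OF assms continuous_on_param])
     (use param_image edge_subset_network in blast)

lemma filterlim_param_inv:
  assumes "x \<in> e"
  shows "filterlim (param_inv n p e) (at (param_inv n p e x) within {0..mesh n}) (at x within e)"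
  unfolding filterlim_at
proof
  show "(param_inv n p e \<longlongrightarrow> param_inv n p e x) (at x within e)"
    using continuous_on_param_inv assms by (auto simp: continuous_on_def)
  have "param_inv n p e y \<noteq> param_inv n p e x" if "y \<in> e" "y \<noteq> x" for y
    using that assms param_param_inv by metis
  then show "\<forall>\<^sub>F y in at x within e. param_inv n p e y \<in> {0..mesh n} \<and> param_inv n p e y \<noteq> param_inv n p e x"
    unfolding eventually_at_filter using param_inv_in by (intro always_eventually) blast
qed

end

context unit_triangle
begin

lemma dist_adj: "adj a n x y \<Longrightarrow> dist x y = mesh n"
  by (elim adjD) (simp add: dist_edge_ends)

text \<open>The endpoints are \<open>mesh n\<close> apart, and an isometry on an interval of that
  length can attain this distance only between its two ends. The orientation stays
  undetermined.\<close>

lemma param_ends: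
  assumes params: "arc_length_params a n p" and xy: "adj a n x y" and e: "e = closed_segment x y"
  shows "p e 0 = x \<and> p e (mesh n) = y \<or> p e 0 = y \<and> p e (mesh n) = x"
proof -
  have ee: "e \<in> edges a n" using xy e by (simp add: adj_def)
  have xe: "x \<in> e" and ye: "y \<in> e" using e by auto
  note q = param_inv_in[OF params ee xe] param_inv_in[OF params ee ye]
  have "\<bar>param_inv n p e x - param_inv n p e y\<bar> = mesh n"
    using dist_param_inv[OF params ee xe ye] dist_adj[OF xy] by (simp add: dist_real_def)
  with q have "param_inv n p e x = 0 \<and> param_inv n p e y = mesh n \<or> param_inv n p e y = 0 \<and> param_inv n p e x = mesh n"
    by auto
  then show ?thesis
    using param_param_inv[OF params ee xe] param_param_inv[OF params ee ye] by (elim disjE conjE) simp_all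
qed

lemma edge_adj:
  assumes "e \<in> edges a n"
  obtains x y where "adj a n x y" "e = closed_segment x y"
proof -
  obtain w i j where w: "length w = n" "i \<noteq> j" "e = closed_segment (word_map a w (a i)) (word_map a w (a j))"
    using assms edges_iff by blast
  show ?thesis by (rule that[OF adjI[OF w(1,2)] w(3)])
qed

lemma param_rel_interior:
  assumes params: "arc_length_params a n p" and e: "e \<in> edges a n" and t: "0 < t" "t < mesh n"
  shows "p e t \<in> rel_interior e"
proof -
  obtain x y where xy: "adj a n x y" "e = closed_segment x y" using edge_adj[OF e] .
  have I: "t \<in> {0..mesh n}" "0 \<in> {0..mesh n}" "mesh n \<in> {0..mesh n}" using t by auto
  have "p e t \<noteq> p e 0" "p e t \<noteq> p e (mesh n)"
    using inj_on_eq_iff[OF param_inj[OF params e] I(1)] I(2,3) t by simp_all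
  then have "p e t \<noteq> x" "p e t \<noteq> y" using param_ends[OF params xy] by auto
  moreover have "p e t \<in> closed_segment x y" using param_image[OF params e] I(1) xy(2) by blast
  moreover have "x \<noteq> y" using dist_adj[OF xy(1)] mesh_pos[of n] by (auto simp del: mesh_pos)
  ultimately show ?thesis using xy(2) by (auto simp: rel_interior_closed_segment open_segment_def)
qed

lemma viscosity_edge_subsolution:
  assumes params: "arc_length_params a n p" and e: "e \<in> edges a n"
    and sub: "subsolution a n p f u" and u: "continuous_on (network a n) u"
    and M: "\<And>x. x \<in> e \<Longrightarrow> f x \<le> M"
  shows "interval_subsolution (mesh n) M (\<lambda>s. u (p e s))"
  unfolding interval_subsolution_def
proof (intro conjI allI impI continuous_on_edge_param[OF params e u])
  fix \<psi> \<psi>' :: "real \<Rightarrow> real" and t :: real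
  assume t: "0 < t" "t < mesh n" and der: "\<forall>s. (\<psi> has_real_derivative \<psi>' s) (at s)"
    and max: "\<forall>\<^sub>F s in at t. u (p e s) - \<psi> s \<le> u (p e t) - \<psi> t"
  obtain \<phi> r where \<phi>: "test_fun a n p e (p e t) \<phi>" "edge_deriv n p e \<phi> (p e t) = \<psi>' t"
    "filterlim r (nhds t) (at (p e t) within network a n)" "r (p e t) = t"
    "\<And>y. u y - \<phi> y = u (p e (r y)) - \<psi> (r y)"
    by (rule edge_test_function[OF params e u t der]) (rule that)
  have "\<forall>\<^sub>F s in nhds t. u (p e s) - \<psi> s \<le> u (p e t) - \<psi> t"
    using max by (auto simp: eventually_nhds_conv_at)
  \<comment> \<open>The full neighbourhood filter at \<open>t\<close> is needed here:
    \<open>r\<close> may send network points other than \<open>p e t\<close> to \<open>t\<close>,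
    where the inequality is an equality.\<close>
  then have "local_max_on (network a n) (\<lambda>y. u y - \<phi> y) (p e t)"
    using \<phi> unfolding local_max_on_def by (auto dest: eventually_compose_filterlim)
  then have "\<bar>\<psi>' t\<bar> \<le> f (p e t)"
    using sub[unfolded subsolution_def, THEN conjunct2, THEN conjunct1, THEN bspec, OF e, THEN bspec,
        OF param_rel_interior[OF params e t], THEN spec[of _ \<phi>]] \<phi>(1,2) by simp
  also have "p e t \<in> e" using param_image[OF params e] t by force
  then have "f (p e t) \<le> M" by (rule M)
  finally show "\<bar>\<psi>' t\<bar> \<le> M" .
qed

lemma viscosity_edge_supersolution:
  assumes params: "arc_length_params a n p" and e: "e \<in> edges a n"
    and super: "supersolution a n p f u" and u: "continuous_on (network a n) u"
    and m: "\<And>x. x \<in> e \<Longrightarrow> m \<le> f x"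
  shows "interval_supersolution (mesh n) m (\<lambda>s. u (p e s))"
  unfolding interval_supersolution_def
proof (intro conjI allI impI continuous_on_edge_param[OF params e u])
  fix \<psi> \<psi>' :: "real \<Rightarrow> real" and t :: real
  assume t: "0 < t" "t < mesh n" and der: "\<forall>s. (\<psi> has_real_derivative \<psi>' s) (at s)"
    and min: "\<forall>\<^sub>F s in at t. u (p e t) - \<psi> t \<le> u (p e s) - \<psi> s"
  obtain \<phi> r where \<phi>: "test_fun a n p e (p e t) \<phi>" "edge_deriv n p e \<phi> (p e t) = \<psi>' t"
    "filterlim r (nhds t) (at (p e t) within network a n)" "r (p e t) = t"
    "\<And>y. u y - \<phi> y = u (p e (r y)) - \<psi> (r y)"
    by (rule edge_test_function[OF params e u t der]) (rule that)
  have "\<forall>\<^sub>F s in nhds t. u (p e t) - \<psi> t \<le> u (p e s) - \<psi> s"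
    using min by (auto simp: eventually_nhds_conv_at)
  then have "local_min_on (network a n) (\<lambda>y. u y - \<phi> y) (p e t)"
    using \<phi> unfolding local_min_on_def by (auto dest: eventually_compose_filterlim)
  then have "f (p e t) \<le> \<bar>\<psi>' t\<bar>"
    using super[unfolded supersolution_def, THEN conjunct2, THEN conjunct1, THEN bspec, OF e, THEN bspec,
        OF param_rel_interior[OF params e t], THEN spec[of _ \<phi>]] \<phi>(1,2) by simp
  moreover have "p e t \<in> e" using param_image[OF params e] t by force
  then have "m \<le> f (p e t)" by (rule m)
  ultimately show "m \<le> \<bar>\<psi>' t\<bar>" by simp
qed

lemma viscosity_solution_continuous:
  "viscosity_solution a n p f u \<Longrightarrow> continuous_on (network a n) u"
  by (intro usc_lsc_continuous_on) (auto simp: viscosity_solution_def subsolution_def supersolution_def)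

lemma viscosity_solution_edge_lipschitz:
  assumes params: "arc_length_params a n p" and e: "e \<in> edges a n"
    and u: "viscosity_solution a n p f u" and M: "\<And>x. x \<in> e \<Longrightarrow> f x \<le> M"
    and xy: "x \<in> e" "y \<in> e"
  shows "\<bar>u x - u y\<bar> \<le> M * dist x y"
proof -
  have "interval_subsolution (mesh n) M (\<lambda>s. u (p e s))"
    using viscosity_edge_subsolution[OF params e _ viscosity_solution_continuous M] u
    by (auto simp: viscosity_solution_def)
  from viscosity_subsolution_lipschitz[OF this param_inv_in[OF params e xy(2)] param_inv_in[OF params e xy(1)]]
  show ?thesis
    by (simp only: param_param_inv[OF params e xy(1)] param_param_inv[OF params e xy(2)]
        dist_param_inv[OF params e xy, symmetric] dist_real_def)
qed

text \<open>At an inner vertex only the constant test function is needed: as \<open>f\<close> is positive, it rules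
  out a local minimum of the solution, so along some edge the solution does descend.\<close>

lemma viscosity_solution_descent:
  assumes params: "arc_length_params a n p" and u: "viscosity_solution a n p f u"
    and x: "x \<in> inner_vertices a n" and fx: "0 < f x"
  obtains y where "adj a n x y"
    "\<And>m. 0 < m \<Longrightarrow> (\<And>z. z \<in> closed_segment x y \<Longrightarrow> m \<le> f z) \<Longrightarrow> u y + m * mesh n \<le> u x"
proof -
  have super: "supersolution a n p f u" using u by (simp add: viscosity_solution_def)
  note cont = viscosity_solution_continuous[OF u]
  have xv: "x \<in> vertices a n" using x by (simp add: inner_vertices_def)
  then have "x \<in> network a n" using vertices_subset_network by blast
  then obtain e where e: "e \<in> Inc a n x" by (auto simp: Inc_def network_def)
  then obtain e' where e': "e' \<in> Inc a n x" and test: "\<And>\<phi>. vertex_test_fun a n p e e' x \<phi> \<Longrightarrow>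
      local_min_on (e \<union> e') (\<lambda>y. u y - \<phi> y) x \<Longrightarrow> f x \<le> \<bar>edge_deriv n p e \<phi> x\<bar>"
    using super[unfolded supersolution_def, THEN conjunct2, THEN conjunct2, THEN bspec, OF x, THEN bspec, OF e]
    by blast
  have deriv0: "edge_deriv n p d (\<lambda>_. 0) x = 0" if "d \<in> Inc a n x" for d
    using that params param_inv_in[OF params, of d x] vector_derivative_within_closed_interval[of 0 "mesh n" "param_inv n p d x" "\<lambda>_. 0" "0::real"]
    by (auto simp: edge_deriv_def Inc_def o_def)
  have "vertex_test_fun a n p e e' x (\<lambda>_. 0)"
    using deriv0 e e' by (auto simp: vertex_test_fun_def edge_differentiable_def o_def)
  then have "\<not> local_min_on (e \<union> e') u x"
    using test[of "\<lambda>_. 0"] deriv0[OF e] fx by auto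
  \<comment> \<open>A local minimum on both edges would be one on their union, so it fails on at
    least one of them; that edge carries the descent.\<close>
  then obtain d where d: "d \<in> Inc a n x" and nomin: "\<not> local_min_on d u x"
    using e e' by (auto simp: local_min_on_def at_within_union eventually_sup)
  then have de: "d \<in> edges a n" and xd: "x \<in> d" by (auto simp: Inc_def)
  then obtain w i j where w: "length w = n" "i \<noteq> j" "d = closed_segment (word_map a w (a i)) (word_map a w (a j))"
    using edges_iff by blast
  then have "x = word_map a w (a i) \<or> x = word_map a w (a j)" using vertex_on_edge xv xd by blast
  then obtain y where y: "adj a n x y" "d = closed_segment x y"
    using adjI[OF w(1,2), of a] adjI[OF w(1) w(2)[symmetric], of a] w(3)
      closed_segment_commute[of "word_map a w (a i)"] by blast
  have "u y + m * mesh n \<le> u x" if m: "0 < m" "\<And>z. z \<in> closed_segment x y \<Longrightarrow> m \<le> f z" for m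
  proof -
    let ?v = "\<lambda>s. u (p d s)"
    have v: "interval_supersolution (mesh n) m ?v"
      by (rule viscosity_edge_supersolution[OF params de super cont]) (use m(2) y(2) in auto)
    have "0 \<in> {0..mesh n}" "mesh n \<in> {0..mesh n}" by (auto intro: less_imp_le)
    note inv = this[THEN param_inv_param[OF params de]]
    \<comment> \<open>Every point of the edge is recovered from its parameter, so a minimum in the
      parameter is a minimum on the edge.\<close>
    have unparam: "eventually (\<lambda>z. P (p d (param_inv n p d z))) (at x within d) \<Longrightarrow> eventually P (at x within d)" for P
      unfolding eventually_at_filter by (elim eventually_mono) (use param_param_inv[OF params de] in auto)
    from param_ends[OF params y] show ?thesis
    proof
      assume ends: "p d 0 = x \<and> p d (mesh n) = y"
      have "\<not> eventually (\<lambda>s. ?v 0 \<le> ?v s) (at 0 within {0..mesh n})"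
      proof
        assume "eventually (\<lambda>s. ?v 0 \<le> ?v s) (at 0 within {0..mesh n})"
        moreover have "filterlim (param_inv n p d) (at 0 within {0..mesh n}) (at x within d)"
          using filterlim_param_inv[OF params de xd] inv ends by auto
        ultimately have "eventually (\<lambda>z. ?v 0 \<le> ?v (param_inv n p d z)) (at x within d)"
          by (rule eventually_compose_filterlim)
        then show False using nomin unparam[of "\<lambda>z. u x \<le> u z"] ends by (simp add: local_min_on_def)
      qed
      from viscosity_supersolution_descent[OF v mesh_pos m(1) this] ends show ?thesis by simp
    next
      \<comment> \<open>Here \<open>x\<close> sits at the right end of the parameter interval;
        reflection moves it to 0.\<close>
      assume ends: "p d 0 = y \<and> p d (mesh n) = x"
      have "\<not> eventually (\<lambda>s. ?v (mesh n - 0) \<le> ?v (mesh n - s)) (at 0 within {0..mesh n})"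
      proof
        assume *: "eventually (\<lambda>s. ?v (mesh n - 0) \<le> ?v (mesh n - s)) (at 0 within {0..mesh n})"
        have "filterlim (param_inv n p d) (at (mesh n) within {0..mesh n}) (at x within d)"
          using filterlim_param_inv[OF params de xd] inv ends by auto
        moreover have "filterlim (\<lambda>s. mesh n - s) (at 0 within {0..mesh n}) (at (mesh n) within {0..mesh n})"
          unfolding filterlim_at by (auto intro!: tendsto_eq_intros simp: eventually_at_filter)
        ultimately have "eventually (\<lambda>z. ?v (mesh n - 0) \<le> ?v (mesh n - (mesh n - param_inv n p d z))) (at x within d)"
          using eventually_compose_filterlim[OF eventually_compose_filterlim[OF *]] by blast
        then show False using nomin unparam[of "\<lambda>z. u x \<le> u z"] ends by (simp add: local_min_on_def)
      qed
      from viscosity_supersolution_descent[OF interval_supersolution_reflect[OF v] mesh_pos m(1) this] ends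
      show ?thesis by simp
    qed
  qed
  then show ?thesis using that y(1) by blast
qed

end

section \<open>Comparison of the solutions\<close>

text \<open>\<open>U\<close> decreases by at least \<open>\<mu>\<close> in each step towards the boundary, so \<open>(U x - \<kappa>) / \<mu>\<close>
  bounds the number of steps, each of which contributes an error of at most \<open>\<delta>\<close>.\<close>

lemma descent_comparison:
  fixes U W c :: "'a \<Rightarrow> real"
  assumes fin: "finite V" and "0 < \<mu>" "0 \<le> \<delta>"
    and step: "\<And>x. x \<in> V - B \<Longrightarrow> \<exists>y\<in>V. U y + c x \<le> U x \<and> U y + \<mu> \<le> U x \<and> W x \<le> W y + c x + \<delta>"
    and bdry: "\<And>x. x \<in> B \<Longrightarrow> W x \<le> U x \<and> \<kappa> \<le> U x"
    and "x \<in> V"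
  shows "W x \<le> U x + \<delta> / \<mu> * (U x - \<kappa>)"
  using \<open>x \<in> V\<close>
\<comment> \<open>Since \<open>U\<close> strictly drops along a step, the number of vertices with
  smaller value drops too, which makes the descent terminate.\<close>
proof (induction "card {z \<in> V. U z < U x}" arbitrary: x rule: less_induct)
  case less
  show ?case
  proof (cases "x \<in> B")
    case True
    then have "0 \<le> \<delta> / \<mu> * (U x - \<kappa>)" using bdry assms(2,3) by simp
    then show ?thesis using bdry[OF True] by simp
  next
    case False
    then obtain y where y: "y \<in> V" "U y + c x \<le> U x" "U y + \<mu> \<le> U x" "W x \<le> W y + c x + \<delta>"
      using step less.prems by blast
    have "{z \<in> V. U z < U y} \<subset> {z \<in> V. U z < U x}"
      using y(1,3) \<open>0 < \<mu>\<close> by force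
    then have "card {z \<in> V. U z < U y} < card {z \<in> V. U z < U x}"
      by (intro psubset_card_mono) (use fin in auto)
    from less.hyps[OF this y(1)] have "W y \<le> U y + \<delta> / \<mu> * (U y - \<kappa>)" .
    \<comment> \<open>A drop of \<open>U\<close> by \<open>\<mu>\<close> lowers the error allowance
      by exactly \<open>\<delta>\<close>, which pays for this step.\<close>
    moreover have "\<delta> / \<mu> * (U y - \<kappa>) \<le> \<delta> / \<mu> * (U x - \<mu> - \<kappa>)"
      using y(3) assms(2,3) by (intro mult_left_mono) auto
    moreover have "\<delta> / \<mu> * (U x - \<mu> - \<kappa>) = \<delta> / \<mu> * (U x - \<kappa>) - \<delta>"
      using assms(2) by (simp add: field_simps)
    ultimately show ?thesis using y(2,4) by linarith
  qed
qed

text \<open>The limit is the infimum of \<open>b n + \<epsilon> n\<close>: each such value bounds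
  all later terms from above, and \<open>b n\<close> can lie below the infimum by at most
  \<open>\<epsilon> n\<close>.\<close>

lemma convergent_almost_decreasing:
  fixes b \<epsilon> :: "nat \<Rightarrow> real"
  assumes dec: "\<And>n m. N \<le> n \<Longrightarrow> n \<le> m \<Longrightarrow> b m \<le> b n + \<epsilon> n"
    and eps: "\<epsilon> \<longlonglongrightarrow> 0" and lower: "\<And>n. N \<le> n \<Longrightarrow> K \<le> b n"
  shows "convergent b"
proof -
  define l where "l = (INF n\<in>{N..}. b n + \<epsilon> n)"
  have "K \<le> b n + \<epsilon> n" if "N \<le> n" for n
    using dec[of n n] lower[of n] that by simp
  then have bdd: "bdd_below ((\<lambda>n. b n + \<epsilon> n) ` {N..})" by (intro bdd_belowI2[of _ K]) auto
  have low: "l - \<epsilon> n \<le> b n" if "N \<le> n" for n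
    using cINF_lower[OF bdd, of n] that by (simp add: l_def)
  have "b \<longlonglongrightarrow> l"
  proof (rule order_tendstoI)
    fix c assume "c < l"
    have "(\<lambda>n. l - \<epsilon> n) \<longlonglongrightarrow> l - 0" by (intro tendsto_intros eps)
    then have "eventually (\<lambda>n. c < l - \<epsilon> n) sequentially" using \<open>c < l\<close> by (auto dest: order_tendstoD(1))
    then show "eventually (\<lambda>n. c < b n) sequentially"
      using eventually_ge_at_top[of N] by eventually_elim (use low in fastforce)
  next
    fix c assume "l < c"
    then obtain n where n: "N \<le> n" "b n + \<epsilon> n < c"
      using cINF_less_iff[OF _ bdd, of c] by (auto simp: l_def)
    show "eventually (\<lambda>n. b n < c) sequentially"
      using eventually_ge_at_top[of n] by eventually_elim (use dec n in fastforce)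
  qed
  then show ?thesis by (auto simp: convergent_def)
qed

text \<open>A real \<open>SUP\<close> says something only for nonempty bounded families; the uniform
  bound supplies boundedness for large \<open>n\<close>, and is halved to make the final inequality
  strict.\<close>

lemma SUP_abs_tendsto_0:
  fixes F :: "nat \<Rightarrow> 'a \<Rightarrow> real"
  assumes ev: "\<And>\<epsilon>. 0 < \<epsilon> \<Longrightarrow> eventually (\<lambda>n. \<forall>x\<in>A n. \<bar>F n x\<bar> \<le> \<epsilon>) sequentially"
    and ne: "\<And>n. A n \<noteq> {}"
  shows "(\<lambda>n. SUP x\<in>A n. \<bar>F n x\<bar>) \<longlonglongrightarrow> 0"
proof (rule tendstoI)
  fix \<epsilon> :: real assume "0 < \<epsilon>"
  then have "eventually (\<lambda>n. \<forall>x\<in>A n. \<bar>F n x\<bar> \<le> \<epsilon> / 2) sequentially" by (intro ev) simp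
  then show "eventually (\<lambda>n. dist (SUP x\<in>A n. \<bar>F n x\<bar>) 0 < \<epsilon>) sequentially"
  proof eventually_elim
    case (elim n)
    obtain x where "x \<in> A n" using ne by blast
    have "bdd_above ((\<lambda>x. \<bar>F n x\<bar>) ` A n)" using elim by (intro bdd_aboveI2[of _ _ "\<epsilon> / 2"]) auto
    from cSUP_upper[OF \<open>x \<in> A n\<close> this] have "0 \<le> (SUP x\<in>A n. \<bar>F n x\<bar>)"
      using abs_ge_zero order_trans by blast
    moreover have "(SUP x\<in>A n. \<bar>F n x\<bar>) \<le> \<epsilon> / 2" by (rule cSUP_least) (use ne elim in auto)
    ultimately show ?case using \<open>0 < \<epsilon>\<close> by simp
  qed
qed

section \<open>Bounds for the data and the oscillation of \<open>f\<close>\<close>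

locale gasket_eikonal = unit_triangle a for a :: "3 \<Rightarrow> real^2" +
  fixes f g :: "real^2 \<Rightarrow> real" and p :: "nat \<Rightarrow> param" and uh u :: "nat \<Rightarrow> real^2 \<Rightarrow> real"
  assumes f_cont: "continuous_on (gasket a) f"
    and f_pos: "0 < (INF x\<in>gasket a. f x)"
    and uh_sol: "discrete_solution a n f g (uh n)"
    and params: "arc_length_params a n (p n)"
    and u_sol: "viscosity_solution a n (p n) f (u n)"
    and u_bdry: "x \<in> range a \<Longrightarrow> u n x = g x"
begin

definition fmin :: real where "fmin = (INF x\<in>gasket a. f x)"
definition fmax :: real where "fmax = (SUP x\<in>gasket a. f x)"

definition osc :: "nat \<Rightarrow> real" where
  "osc n = modulus_of_continuity (gasket a) f (mesh n powr (1/2))"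

definition gmin :: real where "gmin = Min (g ` range a)"

text \<open>A vertex is reached from a corner along edges of lengths at most 1/2, 1/4 and so on, of
  total length below 1; so \<open>fmax\<close> bounds the change from the boundary value.\<close>

definition bound :: real where "bound = Max ((\<lambda>x. \<bar>g x\<bar>) ` range a) + fmax"

lemma fmin_pos: "0 < fmin"
  using f_pos by (simp add: fmin_def)

lemma
  assumes "x \<in> gasket a"
  shows fmin_le: "fmin \<le> f x" and fmax_ge: "f x \<le> fmax"
proof -
  have "compact (f ` gasket a)" by (rule compact_continuous_image[OF f_cont compact_gasket])
  then have "bdd_below (f ` gasket a)" "bdd_above (f ` gasket a)"
    by (auto intro: bounded_imp_bdd_below bounded_imp_bdd_above compact_imp_bounded)
  then show "fmin \<le> f x" "f x \<le> fmax"
    unfolding fmin_def fmax_def using assms by (auto intro: cINF_lower cSUP_upper)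
qed

lemma vertex_in_gasket: "a i \<in> gasket a"
  using range_subset_vertices vertices_subset_gasket by blast

lemma fmax_pos: "0 < fmax"
  using fmin_pos fmin_le[OF vertex_in_gasket] fmax_ge[OF vertex_in_gasket] by (meson less_le_trans)

lemma edge_in_gasket: "e \<in> edges a n \<Longrightarrow> e \<subseteq> gasket a"
  using network_subset_gasket by (auto simp: network_def)

lemma modulus_bound:
  assumes "\<And>x y. x \<in> gasket a \<Longrightarrow> y \<in> gasket a \<Longrightarrow> geodesic_dist (gasket a) x y \<le> ennreal r \<Longrightarrow> \<bar>f x - f y\<bar> \<le> c"
    and "0 \<le> r"
  shows "modulus_of_continuity (gasket a) f r \<le> c"
  unfolding modulus_of_continuity_def
proof (rule cSup_least)
  have "geodesic_dist (gasket a) (a 1) (a 1) \<le> ennreal (dist (a 1) (a 1))"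
    using vertex_in_gasket by (intro geodesic_dist_le_segment) auto
  then have "geodesic_dist (gasket a) (a 1) (a 1) \<le> ennreal r" by simp
  then show "{\<bar>f x - f y\<bar> |x y. x \<in> gasket a \<and> y \<in> gasket a \<and> geodesic_dist (gasket a) x y \<le> ennreal r} \<noteq> {}"
    using vertex_in_gasket by blast
qed (use assms in auto)

lemma modulus_ge:
  assumes "x \<in> gasket a" "y \<in> gasket a" "geodesic_dist (gasket a) x y \<le> ennreal r"
  shows "\<bar>f x - f y\<bar> \<le> modulus_of_continuity (gasket a) f r"
  unfolding modulus_of_continuity_def
proof (rule cSup_upper)
  have "\<bar>f x - f y\<bar> \<le> fmax - fmin" if "x \<in> gasket a" "y \<in> gasket a" for x y
    using fmin_le[OF that(1)] fmin_le[OF that(2)] fmax_ge[OF that(1)] fmax_ge[OF that(2)] by linarith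
  then show "bdd_above {\<bar>f x - f y\<bar> |x y. x \<in> gasket a \<and> y \<in> gasket a \<and> geodesic_dist (gasket a) x y \<le> ennreal r}"
    by (intro bdd_aboveI[of _ "fmax - fmin"]) blast
qed (use assms in blast)

text \<open>The segment joining the points lies in the gasket, so their geodesic distance is at most
  \<open>mesh n\<close>, and this is at most its square root because \<open>mesh n\<close> does not
  exceed 1.\<close>

lemma osc_edge:
  assumes e: "e \<in> edges a n" and "x \<in> e" "y \<in> e"
  shows "\<bar>f x - f y\<bar> \<le> osc n"
  unfolding osc_def
proof (rule modulus_ge)
  show "x \<in> gasket a" "y \<in> gasket a" using assms edge_in_gasket by auto
  have "closed_segment x y \<subseteq> gasket a"
    using closed_segment_subset[OF assms(2,3) convex_edge[OF e]] edge_in_gasket[OF e] by blast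
  then have "geodesic_dist (gasket a) x y \<le> ennreal (dist x y)" by (rule geodesic_dist_le_segment)
  also have "dist x y \<le> mesh n powr (1/2)"
  proof -
    have "mesh n powr 1 \<le> mesh n powr (1/2)"
      using mesh_le_1[of n] by (intro powr_mono') (auto intro: less_imp_le)
    then show ?thesis using dist_in_edge[OF assms] by simp
  qed
  finally show "geodesic_dist (gasket a) x y \<le> ennreal (mesh n powr (1/2))" by (simp add: ennreal_leI)
qed

lemma osc_nonneg: "0 \<le> osc n"
proof -
  have "0 \<le> \<bar>f (a 1) - f (a 1)\<bar>" by simp
  also have "\<dots> \<le> osc n"
    unfolding osc_def
  proof (rule modulus_ge[OF vertex_in_gasket vertex_in_gasket])
    have "geodesic_dist (gasket a) (a 1) (a 1) \<le> ennreal (dist (a 1) (a 1))"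
      using vertex_in_gasket by (intro geodesic_dist_le_segment) auto
    then show "geodesic_dist (gasket a) (a 1) (a 1) \<le> ennreal (mesh n powr (1/2))" by simp
  qed
  finally show ?thesis .
qed

lemma osc_le: "osc n \<le> fmax"
  unfolding osc_def
proof (rule modulus_bound)
  fix x y assume "x \<in> gasket a" "y \<in> gasket a"
  then show "\<bar>f x - f y\<bar> \<le> fmax"
    using fmin_le[of x] fmin_le[of y] fmax_ge[of x] fmax_ge[of y] fmin_pos by linarith
qed simp

lemma osc_tendsto_0: "osc \<longlonglongrightarrow> 0"
proof (rule tendstoI)
  fix \<epsilon> :: real assume "0 < \<epsilon>"
  then obtain d where d: "0 < d" "\<And>x y. x \<in> gasket a \<Longrightarrow> y \<in> gasket a \<Longrightarrow> dist y x < d \<Longrightarrow> dist (f y) (f x) < \<epsilon> / 2"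
    using compact_uniformly_continuous[OF f_cont compact_gasket]
    unfolding uniformly_continuous_on_def by (metis half_gt_zero)
  have "(\<lambda>n. mesh n powr (1/2)) \<longlonglongrightarrow> 0 powr (1/2)"
    by (intro tendsto_powr' mesh_tendsto_0 tendsto_const) auto
  then have "eventually (\<lambda>n. mesh n powr (1/2) < d) sequentially"
    using d(1) by (auto dest: order_tendstoD(2))
  then show "eventually (\<lambda>n. dist (osc n) 0 < \<epsilon>) sequentially"
  proof eventually_elim
    case (elim n)
    have "osc n \<le> \<epsilon> / 2"
      unfolding osc_def
    proof (rule modulus_bound)
      fix x y assume xy: "x \<in> gasket a" "y \<in> gasket a" "geodesic_dist (gasket a) x y \<le> ennreal (mesh n powr (1/2))"
      have "ennreal (dist x y) \<le> ennreal (mesh n powr (1/2))"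
        using dist_le_geodesic_dist xy(3) by (rule order_trans)
      then have "dist x y < d" using elim by simp
      then show "\<bar>f x - f y\<bar> \<le> \<epsilon> / 2"
        using d(2)[of y x] xy by (simp add: dist_real_def)
    qed simp
    then show ?case using osc_nonneg[of n] \<open>0 < \<epsilon>\<close> by simp
  qed
qed

section \<open>One-step inequalities for both solutions\<close>

lemma u_edge_ends:
  assumes "length w \<le> m" "i \<noteq> j"
    and "\<And>z. z \<in> closed_segment (word_map a w (a i)) (word_map a w (a j)) \<Longrightarrow> f z \<le> K"
  shows "\<bar>u m (word_map a w (a i)) - u m (word_map a w (a j))\<bar> \<le> K * mesh (length w)"
  using assms
\<comment> \<open>Edges of level \<open>m\<close> are the base case. A coarser edge is cut at its
  midpoint, and the bound \<open>K\<close> holds on both halves, so refinement does not worsen the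
  estimate.\<close>
proof (induction "m - length w" arbitrary: w)
  case 0
  then have "closed_segment (word_map a w (a i)) (word_map a w (a j)) \<in> edges a m"
    unfolding edges_iff by (metis diff_is_0_eq le_antisym)
  from viscosity_solution_edge_lipschitz[OF params this u_sol, of K "word_map a w (a i)" "word_map a w (a j)"] 0
  show ?case by (simp add: dist_edge_ends)
next
  case (Suc d)
  let ?c = "word_map a (w @ [i]) (a j)"
  have c: "?c = word_map a (w @ [j]) (a i)" using contraction_swap[of a i j] by simp
  note halves = edge_halves[OF Suc.prems(2), of a w]
  have "\<bar>u m (word_map a (w @ [i]) (a i)) - u m ?c\<bar> \<le> K * mesh (length (w @ [i]))"
    by (rule Suc.hyps(1)) (use Suc.hyps(2) Suc.prems halves in auto)
  moreover have "\<bar>u m (word_map a (w @ [j]) (a i)) - u m (word_map a (w @ [j]) (a j))\<bar> \<le> K * mesh (length (w @ [j]))"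
    by (rule Suc.hyps(1)) (use Suc.hyps(2) Suc.prems halves in auto)
  ultimately have "\<bar>u m (word_map a w (a i)) - u m ?c\<bar> + \<bar>u m ?c - u m (word_map a w (a j))\<bar> \<le> K * mesh (length w)"
    unfolding c by (simp add: mesh_Suc)
  then show ?case by linarith
qed

lemma u_adj:
  assumes "adj a n x y" "n \<le> m" "\<And>z. z \<in> closed_segment x y \<Longrightarrow> f z \<le> K"
  shows "\<bar>u m x - u m y\<bar> \<le> K * mesh n"
  using assms(1)
proof (rule adjD)
  fix w i j assume "length w = n" "i \<noteq> j" "x = word_map a w (a i)" "y = word_map a w (a j)"
  with u_edge_ends[of w m i j K] assms(2,3) show ?thesis by simp
qed

text \<open>The discrete scheme samples \<open>f\<close> only at \<open>x\<close>; replacing the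
  maximum of \<open>f\<close> on the edge by \<open>f x\<close> costs one oscillation.\<close>

lemma u_adj_osc:
  assumes "adj a n x y" "n \<le> m"
  shows "u m x \<le> u m y + mesh n * (f x + osc n)"
proof -
  have e: "closed_segment x y \<in> edges a n" using assms(1) by (simp add: adj_def)
  have "f z \<le> f x + osc n" if "z \<in> closed_segment x y" for z
    using osc_edge[OF e that, of x] by auto
  from u_adj[OF assms this] show ?thesis by (simp add: algebra_simps)
qed

lemma u_descent:
  assumes "x \<in> vertices a n - range a"
  obtains y where "adj a n x y" "u n y + mesh n * (f x - osc n) \<le> u n x" "u n y + mesh n * fmin \<le> u n x"
proof -
  have x: "x \<in> inner_vertices a n" using assms by (simp add: inner_vertices_def)
  have xg: "x \<in> gasket a" using assms vertices_subset_gasket by blast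
  have "0 < f x" using fmin_le[OF xg] fmin_pos by simp
  from viscosity_solution_descent[OF params u_sol x this] obtain y where y: "adj a n x y"
    and desc: "\<And>m. 0 < m \<Longrightarrow> (\<And>z. z \<in> closed_segment x y \<Longrightarrow> m \<le> f z) \<Longrightarrow> u n y + m * mesh n \<le> u n x"
    by metis
  have e: "closed_segment x y \<in> edges a n" using y by (simp add: adj_def)
  \<comment> \<open>The maximum gives both estimates at the same neighbour, and it stays positive
    even if \<open>f x - osc n\<close> does not.\<close>
  let ?m = "max fmin (f x - osc n)"
  have "?m \<le> f z" if "z \<in> closed_segment x y" for z
    using osc_edge[OF e that, of x] fmin_le[of z] edge_in_gasket[OF e] that by auto
  then have "u n y + ?m * mesh n \<le> u n x" using desc fmin_pos by (meson less_max_iff_disj)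
  moreover have "mesh n * (f x - osc n) \<le> ?m * mesh n" "mesh n * fmin \<le> ?m * mesh n"
    by (simp_all add: mult.commute less_imp_le)
  ultimately show ?thesis using that[OF y] by linarith
qed

lemma adj_finite: "finite {y. adj a n y x}"
  by (rule finite_subset[OF _ finite_vertices[of a n]]) (auto simp: adj_def)

lemma uh_inner:
  assumes "x \<in> vertices a n - range a"
  shows "Max ((\<lambda>y. - (1 / mesh n) * (uh n y - uh n x)) ` {y. adj a n y x}) = f x"
  using uh_sol[of n] assms by (auto simp: discrete_solution_def inner_vertices_def)

lemma uh_adj:
  assumes "x \<in> vertices a n - range a" "adj a n x y"
  shows "uh n x \<le> uh n y + mesh n * f x"
proof -
  have "- (1 / mesh n) * (uh n y - uh n x) \<le> f x"
    unfolding uh_inner[OF assms(1), symmetric]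
    by (rule Max_ge) (use adj_finite adj_sym[OF assms(2)] in auto)
  then show ?thesis using mesh_pos[of n] by (simp add: field_simps del: mesh_pos)
qed

lemma uh_descent:
  assumes "x \<in> vertices a n - range a"
  obtains y where "adj a n x y" "uh n x = uh n y + mesh n * f x"
proof -
  \<comment> \<open>Only a nonempty set attains its \<open>Max\<close>; the existence of a neighbour
    is taken from the descent of \<open>u n\<close>.\<close>
  obtain y0 where "adj a n x y0" using u_descent[OF assms] by blast
  then have "f x \<in> (\<lambda>y. - (1 / mesh n) * (uh n y - uh n x)) ` {y. adj a n y x}"
    unfolding uh_inner[OF assms, symmetric] using adj_finite adj_sym[of a n x y0] by (intro Max_in) auto
  then obtain y where y: "adj a n y x" "f x = - (1 / mesh n) * (uh n y - uh n x)" by auto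
  then have "uh n x = uh n y + mesh n * f x" using mesh_pos[of n] by (simp add: field_simps del: mesh_pos)
  then show ?thesis using that adj_sym[OF y(1)] by blast
qed

lemma uh_bdry: "x \<in> range a \<Longrightarrow> uh n x = g x"
  using uh_sol[of n] by (auto simp: discrete_solution_def)

lemma gmin_le: "x \<in> range a \<Longrightarrow> gmin \<le> g x"
  unfolding gmin_def by (intro Min_le) auto

lemma abs_g_le: "x \<in> range a \<Longrightarrow> \<bar>g x\<bar> \<le> bound - fmax"
  using Max_ge[of "(\<lambda>x. \<bar>g x\<bar>) ` range a" "\<bar>g x\<bar>"] by (simp add: bound_def)

section \<open>Comparison of the two solutions and of two levels\<close>

lemma u_le_uh:
  assumes "x \<in> vertices a n"
  shows "u n x \<le> uh n x + osc n / fmin * (uh n x - gmin)"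
proof -
  \<comment> \<open>Error per step over drop per step, left unreduced to match the comparison lemma;
    \<open>mesh n\<close> cancels at the end.\<close>
  have "u n x \<le> uh n x + (mesh n * osc n) / (mesh n * fmin) * (uh n x - gmin)"
  proof (rule descent_comparison[OF finite_vertices _ _ _ _ assms, where B = "range a" and c = "\<lambda>x. mesh n * f x"])
    fix x assume x: "x \<in> vertices a n - range a"
    obtain y where y: "adj a n x y" "uh n x = uh n y + mesh n * f x" using uh_descent[OF x] .
    have "fmin \<le> f x" using x vertices_subset_gasket fmin_le by blast
    then have "mesh n * fmin \<le> mesh n * f x" by simp
    moreover have "y \<in> vertices a n" using y(1) by (simp add: adj_def)
    ultimately show "\<exists>y\<in>vertices a n. uh n y + mesh n * f x \<le> uh n x \<and> uh n y + mesh n * fmin \<le> uh n x \<and>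
        u n x \<le> u n y + mesh n * f x + mesh n * osc n"
      using y u_adj_osc[OF y(1) order_refl] by (intro bexI[of _ y]) (auto simp: algebra_simps)
  qed (auto simp: fmin_pos osc_nonneg uh_bdry u_bdry gmin_le less_imp_le)
  then show ?thesis by simp
qed

text \<open>Here \<open>u n\<close> leads the descent. Only \<open>mesh n * (f x - osc n)\<close> is
  guaranteed per step while \<open>uh n\<close> may grow by \<open>mesh n * f x\<close>, so the
  mismatch is again one oscillation.\<close>

lemma uh_le_u:
  assumes "x \<in> vertices a n"
  shows "uh n x \<le> u n x + osc n / fmin * (u n x - gmin)"
proof -
  have "uh n x \<le> u n x + (mesh n * osc n) / (mesh n * fmin) * (u n x - gmin)"
  proof (rule descent_comparison[OF finite_vertices _ _ _ _ assms, where B = "range a" and c = "\<lambda>x. mesh n * (f x - osc n)"])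
    fix x assume x: "x \<in> vertices a n - range a"
    obtain y where y: "adj a n x y" "u n y + mesh n * (f x - osc n) \<le> u n x" "u n y + mesh n * fmin \<le> u n x"
      using u_descent[OF x] .
    then have "y \<in> vertices a n" by (simp add: adj_def)
    then show "\<exists>y\<in>vertices a n. u n y + mesh n * (f x - osc n) \<le> u n x \<and> u n y + mesh n * fmin \<le> u n x \<and>
        uh n x \<le> uh n y + mesh n * (f x - osc n) + mesh n * osc n"
      using y uh_adj[OF x y(1)] by (intro bexI[of _ y]) (auto simp: algebra_simps)
  qed (auto simp: fmin_pos osc_nonneg uh_bdry u_bdry gmin_le less_imp_le)
  then show ?thesis by simp
qed

text \<open>The descent of \<open>u n\<close> runs along edges of level \<open>n\<close>, on which
  growth of \<open>u m\<close> is still controlled. One oscillation is lost in the descent and one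
  in the growth, whence the factor 2.\<close>

lemma u_almost_decreasing:
  assumes "x \<in> vertices a n" "n \<le> m"
  shows "u m x \<le> u n x + 2 * osc n / fmin * (u n x - gmin)"
proof -
  have "u m x \<le> u n x + (mesh n * (2 * osc n)) / (mesh n * fmin) * (u n x - gmin)"
  proof (rule descent_comparison[OF finite_vertices _ _ _ _ assms(1), where B = "range a" and c = "\<lambda>x. mesh n * (f x - osc n)"])
    fix x assume x: "x \<in> vertices a n - range a"
    obtain y where y: "adj a n x y" "u n y + mesh n * (f x - osc n) \<le> u n x" "u n y + mesh n * fmin \<le> u n x"
      using u_descent[OF x] .
    then have "y \<in> vertices a n" by (simp add: adj_def)
    then show "\<exists>y\<in>vertices a n. u n y + mesh n * (f x - osc n) \<le> u n x \<and> u n y + mesh n * fmin \<le> u n x \<and>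
        u m x \<le> u m y + mesh n * (f x - osc n) + mesh n * (2 * osc n)"
      using y u_adj_osc[OF y(1) assms(2)] by (intro bexI[of _ y]) (auto simp: algebra_simps)
  qed (auto simp: fmin_pos osc_nonneg uh_bdry u_bdry gmin_le less_imp_le)
  then show ?thesis by simp
qed

section \<open>Variation of the solutions over a cell\<close>

lemma u_cell_same_corner:
  assumes "length w \<le> m" "k \<le> length w"
  shows "\<bar>u m (word_map a w (a i)) - u m (word_map a (take k w) (a i))\<bar> \<le> fmax * (mesh k - mesh (length w))"
  using assms
proof (induction w rule: rev_induct)
  case (snoc j w)
  show ?case
  proof (cases "k \<le> length w")
    case True
    \<comment> \<open>Appending \<open>j\<close> either keeps corner \<open>i\<close> (if
      \<open>i = j\<close>) or moves it to the midpoint of an edge of the cell, along an edge of the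
      next level.\<close>
    have step: "\<bar>u m (word_map a (w @ [j]) (a i)) - u m (word_map a w (a i))\<bar> \<le> fmax * mesh (length (w @ [j]))"
    proof (cases "i = j")
      case False
      have e: "closed_segment (word_map a (w @ [i]) (a j)) (word_map a (w @ [i]) (a i)) \<in> edges a (length (w @ [i]))"
        unfolding edges_iff using False by (intro exI[of _ "w @ [i]"] exI[of _ j] exI[of _ i]) auto
      have "\<bar>u m (word_map a (w @ [i]) (a j)) - u m (word_map a (w @ [i]) (a i))\<bar> \<le> fmax * mesh (length (w @ [i]))"
        by (rule u_edge_ends) (use snoc.prems False edge_in_gasket[OF e] fmax_ge in auto)
      then show ?thesis by (simp add: contraction_swap[of a i j])
    qed (use fmax_pos in \<open>simp add: less_imp_le\<close>)
    have "\<bar>u m (word_map a w (a i)) - u m (word_map a (take k w) (a i))\<bar> \<le> fmax * (mesh k - mesh (length w))"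
      using snoc True by simp
    with step have "\<bar>u m (word_map a (w @ [j]) (a i)) - u m (word_map a (take k w) (a i))\<bar> \<le>
        fmax * mesh (length (w @ [j])) + fmax * (mesh k - mesh (length w))" by linarith
    \<comment> \<open>The lengths form a geometric series, which telescopes because
      \<open>mesh (length w)\<close> is twice the next mesh.\<close>
    also have "\<dots> = fmax * (mesh k - mesh (length (w @ [j])))" by (simp add: mesh_Suc algebra_simps)
    finally show ?thesis using True by simp
  next
    case False
    then have "k = Suc (length w)" using snoc.prems by simp
    then show ?thesis by simp
  qed
qed simp

lemma u_cell:
  assumes "length w \<le> m" "k \<le> length w"
  shows "\<bar>u m (word_map a w (a i)) - u m (word_map a (take k w) (a j))\<bar> \<le> 2 * fmax * mesh k"
proof -
  have "\<bar>u m (word_map a w (a i)) - u m (word_map a (take k w) (a i))\<bar> \<le> fmax * (mesh k - mesh (length w))"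
    by (rule u_cell_same_corner[OF assms])
  also have "\<dots> \<le> fmax * mesh k" using fmax_pos by (simp add: less_imp_le)
  finally have "\<bar>u m (word_map a w (a i)) - u m (word_map a (take k w) (a i))\<bar> \<le> fmax * mesh k" .
  moreover have "\<bar>u m (word_map a (take k w) (a i)) - u m (word_map a (take k w) (a j))\<bar> \<le> fmax * mesh k"
  proof (cases "i = j")
    case False
    have e: "closed_segment (word_map a (take k w) (a i)) (word_map a (take k w) (a j)) \<in> edges a k"
      unfolding edges_iff using False assms by (intro exI[of _ "take k w"] exI[of _ i] exI[of _ j]) auto
    have "\<bar>u m (word_map a (take k w) (a i)) - u m (word_map a (take k w) (a j))\<bar> \<le> fmax * mesh (length (take k w))"
      by (rule u_edge_ends) (use assms False edge_in_gasket[OF e] fmax_ge in auto)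
    then show ?thesis using assms by simp
  qed (use fmax_pos in \<open>simp add: less_imp_le\<close>)
  ultimately show ?thesis by linarith
qed

lemma u_bounded:
  assumes "x \<in> vertices a n" "n \<le> m"
  shows "\<bar>u m x\<bar> \<le> bound"
proof -
  obtain w i where w: "length w = n" "x = word_map a w (a i)" using assms vertices_iff by blast
  have "\<bar>u m x - u m (a i)\<bar> \<le> fmax * (mesh 0 - mesh n)"
    using u_cell_same_corner[of w m 0 i] w assms(2) by simp
  also have "\<dots> \<le> fmax" using fmax_pos mesh_le_1[of n] by (simp add: mesh_def mult_le_cancel_left2)
  finally show ?thesis using abs_g_le[of "a i"] u_bdry[of "a i" m] by simp
qed

lemma bound_pos: "0 < bound"
  using abs_g_le[of "a 1"] fmax_pos by auto

lemma gmin_ge: "- bound \<le> gmin"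
proof -
  have "gmin \<in> g ` range a" unfolding gmin_def by (intro Min_in) auto
  then show ?thesis using abs_g_le fmax_pos by fastforce
qed

text \<open>The error terms involve the heights of \<open>u n\<close> and \<open>uh n\<close> above
  \<open>gmin\<close>. The first is at most \<open>2 * bound\<close>; inserting
  \<open>osc n \<le> fmax\<close> into \<open>uh_le_u\<close> bounds the second uniformly in
  \<open>n\<close>.\<close>

lemma u_uh_estimate:
  assumes "x \<in> vertices a n"
  shows "\<bar>u n x - uh n x\<bar> \<le> (2 * bound + fmax / fmin * (2 * bound)) / fmin * osc n"
proof -
  have q: "0 \<le> osc n / fmin" "osc n / fmin \<le> fmax / fmin"
    using osc_nonneg[of n] osc_le[of n] fmin_pos by (auto intro: divide_right_mono)
  have "\<bar>u n x\<bar> \<le> bound" by (rule u_bounded[OF assms order_refl])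
  then have ub: "u n x - gmin \<le> 2 * bound" using gmin_ge by linarith
  have "osc n / fmin * (u n x - gmin) \<le> osc n / fmin * (2 * bound)"
    using ub q(1) by (rule mult_left_mono)
  with uh_le_u[OF assms] have 1: "uh n x \<le> u n x + osc n / fmin * (2 * bound)" by linarith
  also have "\<dots> \<le> u n x + fmax / fmin * (2 * bound)"
    using q(2) bound_pos by (intro add_left_mono mult_right_mono) auto
  finally have "uh n x - gmin \<le> 2 * bound + fmax / fmin * (2 * bound)" using ub by linarith
  then have "osc n / fmin * (uh n x - gmin) \<le> osc n / fmin * (2 * bound + fmax / fmin * (2 * bound))"
    using q(1) by (rule mult_left_mono)
  with u_le_uh[OF assms] have 2: "u n x \<le> uh n x + osc n / fmin * (2 * bound + fmax / fmin * (2 * bound))"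
    by linarith
  have "osc n / fmin * (2 * bound) \<le> osc n / fmin * (2 * bound + fmax / fmin * (2 * bound))"
    using fmax_pos fmin_pos bound_pos q(1) by (intro mult_left_mono) auto
  with 1 2 have "\<bar>u n x - uh n x\<bar> \<le> osc n / fmin * (2 * bound + fmax / fmin * (2 * bound))" by linarith
  also have "\<dots> = (2 * bound + fmax / fmin * (2 * bound)) / fmin * osc n" by simp
  finally show ?thesis .
qed

text \<open>The index \<open>N\<close> is a level at which \<open>x\<close> is already a vertex; on
  coarser levels \<open>x\<close> may lie off the network.\<close>

lemma u_convergent:
  assumes "x \<in> vertices a N"
  shows "convergent (\<lambda>n. u n x)"
proof (rule convergent_almost_decreasing)
  have xn: "x \<in> vertices a n" if "N \<le> n" for n using assms vertices_mono[OF that] by blast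
  fix n m assume nm: "N \<le> n" "n \<le> m"
  have "u n x - gmin \<le> 2 * bound" using u_bounded[OF xn[OF nm(1)] order_refl] gmin_ge by linarith
  then have "2 * osc n / fmin * (u n x - gmin) \<le> 2 * osc n / fmin * (2 * bound)"
    using osc_nonneg[of n] fmin_pos by (intro mult_left_mono) auto
  with u_almost_decreasing[OF xn[OF nm(1)] nm(2)]
  show "u m x \<le> u n x + 2 * osc n / fmin * (2 * bound)" by linarith
next
  have "(\<lambda>n. 2 * osc n / fmin * (2 * bound)) \<longlonglongrightarrow> 2 * 0 / fmin * (2 * bound)"
    by (intro tendsto_intros osc_tendsto_0) (use fmin_pos in auto)
  then show "(\<lambda>n. 2 * osc n / fmin * (2 * bound)) \<longlonglongrightarrow> 0" by simp
next
  fix n assume "N \<le> n"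
  then show "- bound \<le> u n x" using u_bounded[OF assms, of n] by linarith
qed

section \<open>Equicontinuity on the vertices\<close>

lemma separated_cells:
  "\<exists>d>0. \<forall>w w'. length w = k \<and> length w' = k \<and> (\<exists>x\<in>cell w. \<exists>y\<in>cell w'. dist x y < d) \<longrightarrow> cell w \<inter> cell w' \<noteq> {}"
proof -
  let ?P = "{w :: 3 list. length w = k} \<times> {w :: 3 list. length w = k}"
  have fin: "finite ?P" using finite_lists_length_eq[of "UNIV :: 3 set" k] by simp
  \<comment> \<open>Disjoint compact cells have positive distance, and a word length admits finitely
    many pairs, so a minimum over pairs is still positive.\<close>
  have "\<exists>d>0. \<forall>x\<in>cell (fst q). \<forall>y\<in>cell (snd q). cell (fst q) \<inter> cell (snd q) = {} \<longrightarrow> d \<le> dist x y" for q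
    using separate_compact_closed[OF compact_cell compact_imp_closed[OF compact_cell], of "fst q" "snd q"]
    by (cases "cell (fst q) \<inter> cell (snd q) = {}") (auto intro: exI[of _ 1])
  then obtain D where D: "\<And>q. 0 < D q"
    "\<And>q x y. x \<in> cell (fst q) \<Longrightarrow> y \<in> cell (snd q) \<Longrightarrow> cell (fst q) \<inter> cell (snd q) = {} \<Longrightarrow> D q \<le> dist x y"
    by metis
  have "0 < Min (insert 1 (D ` ?P))" using fin D(1) by auto
  moreover have "cell w \<inter> cell w' \<noteq> {}" if w: "length w = k" "length w' = k"
    and xy: "x \<in> cell w" "y \<in> cell w'" "dist x y < Min (insert 1 (D ` ?P))" for w w' x y
  proof
    assume "cell w \<inter> cell w' = {}"
    then have "D (w, w') \<le> dist x y" using D(2)[of x "(w, w')" y] xy by simp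
    moreover have "Min (insert 1 (D ` ?P)) \<le> D (w, w')" using fin w by (intro Min_le) auto
    ultimately show False using xy(3) by simp
  qed
  ultimately show ?thesis by blast
qed

lemma word_map_append: "word_map a (v @ w) x = word_map a v (word_map a w x)"
  by (induction v) simp_all

lemma vertex_in_prefix_cell: "word_map a w (a i) \<in> cell (take k w)"
proof -
  have "word_map a w (a i) = word_map a (take k w) (word_map a (drop k w) (a i))"
    by (simp flip: word_map_append)
  moreover have "word_map a (drop k w) (a i) \<in> triangle"
    using cell_subset_triangle hull_inc[of "a i" "range a"] by blast
  ultimately show ?thesis by blast
qed

text \<open>Close points lie in level \<open>k\<close> cells that meet, hence share a vertex, and
  each point differs from it by at most \<open>2 * fmax * mesh k\<close>. The distance
  \<open>d\<close> depends on \<open>k\<close> alone, which lets the estimate pass to the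
  limit.\<close>

lemma u_equicontinuous:
  obtains d where "0 < d"
    "\<And>n m x y. x \<in> vertices a n \<Longrightarrow> y \<in> vertices a n \<Longrightarrow> n \<le> m \<Longrightarrow> dist x y < d \<Longrightarrow> k \<le> n \<Longrightarrow>
      \<bar>u m x - u m y\<bar> \<le> 4 * fmax * mesh k"
proof -
  obtain d where d: "0 < d" "\<And>w w' x y. length w = k \<Longrightarrow> length w' = k \<Longrightarrow> x \<in> cell w \<Longrightarrow> y \<in> cell w' \<Longrightarrow>
      dist x y < d \<Longrightarrow> cell w \<inter> cell w' \<noteq> {}"
    using separated_cells[of k] by metis
  have "\<bar>u m x - u m y\<bar> \<le> 4 * fmax * mesh k"
    if x: "x \<in> vertices a n" and y: "y \<in> vertices a n" and nm: "n \<le> m" and xy: "dist x y < d" and kn: "k \<le> n"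
    for n m x y
  proof -
    obtain w i where w: "length w = n" "x = word_map a w (a i)" using x vertices_iff by blast
    obtain w' i' where w': "length w' = n" "y = word_map a w' (a i')" using y vertices_iff by blast
    have len: "length (take k w) = k" "length (take k w') = k" using w w' kn by auto
    have "cell (take k w) \<inter> cell (take k w') \<noteq> {}"
      by (rule d(2)[OF len _ _ xy]) (simp_all only: w w' vertex_in_prefix_cell)
    then obtain j j' where "word_map a (take k w) (a j) = word_map a (take k w') (a j')"
      using cells_meet[of "take k w" "take k w'"] len by auto
    then show ?thesis
      using u_cell[of w m k i j] u_cell[of w' m k i' j'] w w' nm kn by simp
  qed
  with d(1) that show ?thesis by blast
qed

end

section \<open>The common limit\<close>

context gasket_eikonal
begin

lemma u_tendsto_lim:
  assumes "x \<in> (\<Union>n. vertices a n)"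
  shows "(\<lambda>n. u n x) \<longlonglongrightarrow> lim (\<lambda>n. u n x)"
  using assms u_convergent convergent_LIMSEQ_iff by blast

lemma lim_uniformly_continuous:
  "uniformly_continuous_on (\<Union>n. vertices a n) (\<lambda>x. lim (\<lambda>n. u n x))"
  unfolding uniformly_continuous_on_def
proof (intro allI impI)
  fix \<epsilon> :: real assume "0 < \<epsilon>"
  have "(\<lambda>k. 4 * fmax * mesh k) \<longlonglongrightarrow> 4 * fmax * 0" by (intro tendsto_intros mesh_tendsto_0)
  then have "eventually (\<lambda>k. 4 * fmax * mesh k < \<epsilon>) sequentially"
    using \<open>0 < \<epsilon>\<close> by (auto dest: order_tendstoD(2))
  then obtain k where k: "4 * fmax * mesh k < \<epsilon>" by (auto simp: eventually_sequentially)
  obtain d where d: "0 < d" "\<And>n m x y. x \<in> vertices a n \<Longrightarrow> y \<in> vertices a n \<Longrightarrow> n \<le> m \<Longrightarrow> dist x y < d \<Longrightarrow>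
      k \<le> n \<Longrightarrow> \<bar>u m x - u m y\<bar> \<le> 4 * fmax * mesh k"
    using u_equicontinuous[of k] by metis
  have "dist (lim (\<lambda>n. u n y)) (lim (\<lambda>n. u n x)) < \<epsilon>"
    if xy: "x \<in> (\<Union>n. vertices a n)" "y \<in> (\<Union>n. vertices a n)" "dist y x < d" for x y
  proof -
    obtain i j where "x \<in> vertices a i" "y \<in> vertices a j" using xy by blast
    \<comment> \<open>A common level at which both points are vertices and the cells of level
      \<open>k\<close> are available.\<close>
    then have v: "x \<in> vertices a (max k (max i j))" "y \<in> vertices a (max k (max i j))"
      using vertices_mono[of i "max k (max i j)" a] vertices_mono[of j "max k (max i j)" a]
      by (meson max.cobounded1 max.cobounded2 order_trans subsetD)+
    have "(\<lambda>m. \<bar>u m y - u m x\<bar>) \<longlonglongrightarrow> \<bar>lim (\<lambda>n. u n y) - lim (\<lambda>n. u n x)\<bar>"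
      by (intro tendsto_intros u_tendsto_lim xy)
    moreover have "\<forall>m\<ge>max k (max i j). \<bar>u m y - u m x\<bar> \<le> 4 * fmax * mesh k"
      using d(2)[OF v(2,1) _ xy(3)] by auto
    ultimately have "\<bar>lim (\<lambda>n. u n y) - lim (\<lambda>n. u n x)\<bar> \<le> 4 * fmax * mesh k"
      using LIMSEQ_le_const2 by blast
    then show ?thesis using k by (simp add: dist_real_def)
  qed
  then show "\<exists>d>0. \<forall>x\<in>\<Union>n. vertices a n. \<forall>y\<in>\<Union>n. vertices a n. dist y x < d \<longrightarrow>
      dist (lim (\<lambda>n. u n y)) (lim (\<lambda>n. u n x)) < \<epsilon>"
    using d(1) by blast
qed

text \<open>Five errors of size \<open>\<epsilon> / 5\<close>: from \<open>x\<close> to a vertex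
  \<open>?P\<close> on its edge, from there to a corner \<open>?c\<close> of its level
  \<open>k\<close> cell, from \<open>u n\<close> to \<open>v\<close> at \<open>?c\<close>, and back
  to \<open>?P\<close> and \<open>x\<close> with \<open>v\<close>.\<close>

lemma u_uniform_limit:
  assumes cont: "continuous_on (gasket a) v"
    and lim: "\<And>x n. x \<in> vertices a n \<Longrightarrow> (\<lambda>m. u m x) \<longlonglongrightarrow> v x"
    and "0 < \<epsilon>"
  shows "eventually (\<lambda>n. \<forall>x\<in>network a n. \<bar>u n x - v x\<bar> \<le> \<epsilon>) sequentially"
proof -
  have \<epsilon>5: "0 < \<epsilon> / 5" using assms(3) by simp
  have "(\<lambda>k. fmax * mesh k) \<longlonglongrightarrow> fmax * 0" by (intro tendsto_intros mesh_tendsto_0)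
  then have small: "eventually (\<lambda>k. fmax * mesh k < \<epsilon> / 5) sequentially"
    using \<epsilon>5 by (intro order_tendstoD(2)[of _ "fmax * 0"]) auto
  then obtain k where k: "fmax * mesh k < \<epsilon> / 5" by (auto simp: eventually_sequentially)
  obtain d where d: "0 < d" "\<And>x y. x \<in> gasket a \<Longrightarrow> y \<in> gasket a \<Longrightarrow> dist y x < d \<Longrightarrow> dist (v y) (v x) < \<epsilon> / 5"
    using compact_uniformly_continuous[OF cont compact_gasket] \<epsilon>5 unfolding uniformly_continuous_on_def by metis
  \<comment> \<open>Pointwise convergence is uniform on the finite set of level \<open>k\<close>
    vertices.\<close>
  have "eventually (\<lambda>n. \<forall>c\<in>vertices a k. dist (u n c) (v c) < \<epsilon> / 5) sequentially"
    by (intro eventually_ball_finite finite_vertices ballI tendstoD[OF lim \<epsilon>5])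
  moreover have "eventually (\<lambda>n. mesh n < d) sequentially"
    using d(1) by (rule order_tendstoD(2)[OF mesh_tendsto_0])
  ultimately show ?thesis
    using small eventually_ge_at_top[of k]
  proof eventually_elim
    case (elim n)
    show ?case
    proof
      fix x assume "x \<in> network a n"
      then obtain e where e: "e \<in> edges a n" "x \<in> e" by (auto simp: network_def)
      then obtain w i j where w: "length w = n" "e = closed_segment (word_map a w (a i)) (word_map a w (a j))"
        using edges_iff by blast
      let ?P = "word_map a w (a i)" and ?c = "word_map a (take k w) (a i)"
      have P: "?P \<in> e" "?P \<in> vertices a n" using w by (auto simp: vertices_iff)
      have c: "?c \<in> vertices a k" using w elim by (auto simp: vertices_iff intro!: exI[of _ "take k w"])
      have dPx: "dist ?P x \<le> mesh n" by (rule dist_in_edge[OF e(1) P(1) e(2)])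
      have "\<bar>u n x - u n ?P\<bar> \<le> fmax * dist x ?P"
        by (rule viscosity_solution_edge_lipschitz[OF params e(1) u_sol _ e(2) P(1)])
           (use edge_in_gasket[OF e(1)] fmax_ge in blast)
      also have "\<dots> \<le> fmax * mesh n"
        using dPx fmax_pos by (intro mult_left_mono) (auto simp: dist_commute)
      finally have 1: "\<bar>u n x - u n ?P\<bar> < \<epsilon> / 5" using elim by simp
      have cell: "\<bar>u m ?P - u m ?c\<bar> \<le> fmax * mesh k" if "n \<le> m" for m
      proof -
        have "\<bar>u m ?P - u m ?c\<bar> \<le> fmax * (mesh k - mesh (length w))"
          by (rule u_cell_same_corner) (use that w elim in auto)
        also have "\<dots> \<le> fmax * mesh k" using fmax_pos by simp
        finally show ?thesis .
      qed
      have 2: "\<bar>u n ?P - u n ?c\<bar> < \<epsilon> / 5" using cell[of n] k by simp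
      have 3: "\<bar>u n ?c - v ?c\<bar> < \<epsilon> / 5" using elim c by (simp add: dist_real_def)
      \<comment> \<open>The cell estimate holds on every level from \<open>n\<close> on, so the
        limit function inherits it.\<close>
      have "(\<lambda>m. \<bar>u m ?P - u m ?c\<bar>) \<longlonglongrightarrow> \<bar>v ?P - v ?c\<bar>"
        by (intro tendsto_intros lim[OF P(2)] lim[OF c])
      then have "\<bar>v ?P - v ?c\<bar> \<le> fmax * mesh k"
        by (rule LIMSEQ_le_const2) (use cell in blast)
      then have 4: "\<bar>v ?P - v ?c\<bar> < \<epsilon> / 5" using k by simp
      have "?P \<in> gasket a" "x \<in> gasket a" using edge_in_gasket[OF e(1)] P e(2) by auto
      then have 5: "\<bar>v ?P - v x\<bar> < \<epsilon> / 5" using d(2)[of x ?P] dPx elim by (simp add: dist_real_def)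
      from 1 2 3 4 5 show "\<bar>u n x - v x\<bar> \<le> \<epsilon>" by linarith
    qed
  qed
qed

lemma common_limit:
  obtains v where "continuous_on (gasket a) v"
    "(\<lambda>n. SUP x\<in>network a n. \<bar>u n x - v x\<bar>) \<longlonglongrightarrow> 0"
    "(\<lambda>n. SUP x\<in>vertices a n. \<bar>uh n x - v x\<bar>) \<longlonglongrightarrow> 0"
proof -
  \<comment> \<open>The pointwise limit exists only on the vertices; uniform continuity extends it
    to their closure, which is the gasket.\<close>
  obtain v where v: "uniformly_continuous_on (gasket a) v"
    "\<And>x. x \<in> (\<Union>n. vertices a n) \<Longrightarrow> lim (\<lambda>n. u n x) = v x"
    by (rule uniformly_continuous_on_extension_on_closure[OF lim_uniformly_continuous, folded gasket_def])
       (rule that)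
  have cont: "continuous_on (gasket a) v" using v(1) by (rule uniformly_continuous_imp_continuous)
  have lim: "(\<lambda>m. u m x) \<longlonglongrightarrow> v x" if "x \<in> vertices a n" for x n
    using u_tendsto_lim[of x] v(2)[of x] that by auto
  have ev: "eventually (\<lambda>n. \<forall>x\<in>network a n. \<bar>u n x - v x\<bar> \<le> \<epsilon>) sequentially" if "0 < \<epsilon>" for \<epsilon>
    by (rule u_uniform_limit[OF cont lim that])
  have ne: "vertices a n \<noteq> {}" "network a n \<noteq> {}" for n
    using range_subset_vertices[of a n] vertices_subset_network[of a n] by auto
  have "(\<lambda>n. SUP x\<in>network a n. \<bar>u n x - v x\<bar>) \<longlonglongrightarrow> 0"
    by (rule SUP_abs_tendsto_0[OF ev ne(2)])
  moreover have "(\<lambda>n. SUP x\<in>vertices a n. \<bar>uh n x - v x\<bar>) \<longlonglongrightarrow> 0"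
  proof (rule SUP_abs_tendsto_0[OF _ ne(1)])
    fix \<epsilon> :: real assume "0 < \<epsilon>"
    let ?C = "(2 * bound + fmax / fmin * (2 * bound)) / fmin"
    have "(\<lambda>n. ?C * osc n) \<longlonglongrightarrow> ?C * 0" by (intro tendsto_intros osc_tendsto_0)
    then have "eventually (\<lambda>n. ?C * osc n < \<epsilon> / 2) sequentially"
      using \<open>0 < \<epsilon>\<close> by (intro order_tendstoD(2)[of _ "?C * 0"]) auto
    moreover have "eventually (\<lambda>n. \<forall>x\<in>network a n. \<bar>u n x - v x\<bar> \<le> \<epsilon> / 2) sequentially"
      using \<open>0 < \<epsilon>\<close> by (intro ev) simp
    ultimately show "eventually (\<lambda>n. \<forall>x\<in>vertices a n. \<bar>uh n x - v x\<bar> \<le> \<epsilon>) sequentially"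
    proof eventually_elim
      case (elim n)
      show ?case
      proof
        fix x assume x: "x \<in> vertices a n"
        then have "\<bar>u n x - v x\<bar> \<le> \<epsilon> / 2" using elim(2) vertices_subset_network by blast
        then show "\<bar>uh n x - v x\<bar> \<le> \<epsilon>" using u_uh_estimate[OF x] elim(1) by linarith
      qed
    qed
  qed
  ultimately show ?thesis using that cont by blast
qed

end

theorem proposition4p4:
  fixes a :: "3 \<Rightarrow> real^2"
    and f g :: "real^2 \<Rightarrow> real"
    and p :: "nat \<Rightarrow> (real^2) set \<Rightarrow> real \<Rightarrow> real^2"
    and uh u :: "nat \<Rightarrow> real^2 \<Rightarrow> real"
  assumes triangle: "\<And>i j. i \<noteq> j \<Longrightarrow> dist (a i) (a j) = 1"
    and f_cont: "continuous_on (gasket a) f"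
    and f_pos: "(INF x\<in>gasket a. f x) > 0"
    and g_compat: "\<And>n x y. x \<in> range a \<Longrightarrow> y \<in> range a \<Longrightarrow>
          g x \<le> Inf {(\<Sum>k<length xs - 1. mesh n * f (xs ! k)) + g y | xs. graph_path a n x y xs}"
    and uh_sol: "\<And>n. discrete_solution a n f g (uh n)"
    and params: "\<And>n. arc_length_params a n (p n)"
    and u_sol: "\<And>n. viscosity_solution a n (p n) f (u n)"
    and u_bdry: "\<And>n x. x \<in> range a \<Longrightarrow> u n x = g x"
  shows "(\<exists>C. \<forall>n. \<forall>x\<in>vertices a n.
            \<bar>u n x - uh n x\<bar> \<le> C * modulus_of_continuity (gasket a) f (mesh n powr (1/2))) \<and>
         (\<exists>ubar. continuous_on (gasket a) ubar \<and>
            (\<lambda>n. SUP x\<in>network a n. \<bar>u n x - ubar x\<bar>) \<longlonglongrightarrow> 0 \<and>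
            (\<lambda>n. SUP x\<in>vertices a n. \<bar>uh n x - ubar x\<bar>) \<longlonglongrightarrow> 0)"
proof -
  interpret gasket_eikonal a f g p uh u
    by unfold_locales (fact triangle f_cont f_pos uh_sol params u_sol u_bdry)+
  have "\<exists>C. \<forall>n. \<forall>x\<in>vertices a n.
      \<bar>u n x - uh n x\<bar> \<le> C * modulus_of_continuity (gasket a) f (mesh n powr (1/2))"
    using u_uh_estimate unfolding osc_def by blast
  moreover obtain v where "continuous_on (gasket a) v"
    "(\<lambda>n. SUP x\<in>network a n. \<bar>u n x - v x\<bar>) \<longlonglongrightarrow> 0"
    "(\<lambda>n. SUP x\<in>vertices a n. \<bar>uh n x - v x\<bar>) \<longlonglongrightarrow> 0"
    by (rule common_limit)
  ultimately show ?thesis by blast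
qed

end
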